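(* There exists a profinite subgroup $G$ of $S_\infty$ with $\deg(T_G)=\mathbf{0}$ such that $G_{\{\mathbf{0}\}}$ is not an existential-elementary subgroup of $G$; that is, there are an existential formula $\varphi(\bar x)$ in the language of groups and a tuple $\bar a$ from $G_{\{\mathbf{0}\}}$ with $G\models\varphi(\bar a)$ but $G_{\{\mathbf{0}\}}\not\models\varphi(\bar a)$.
   Context: $S_\infty$ is the group of all permutations of $\mathbb{N}$, with the topology of pointwise convergence; its profinite subgroups are exactly the closed subgroups all of whose orbits are finite. For a subgroup $G\le S_\infty$, $T_G\subseteq\mathbb{N}^{<\omega}$ is the tree of all strings of the form $g(0)g^{-1}(0)g(1)g^{-1}(1)\cdots g(n)g^{-1}(n)$ with $g\in G$, $n\in\mathbb{N}$. $\deg(T_G)$ is the Turing join of the degree of the set $T_G$ (under a fixed computable coding of $\mathbb{N}^{<\omega}$ with decidable immediate-predecessor relation) and the degree of the branching function giving the number of immediate successors of each node of $T_G$. For a Turing ideal $I$ with $\deg(T_G)\in I$, $G_I=\{g\in G:\deg(g)\in I\}$, where $\deg(g)$ is the Turing degree of $g$ as a function $\mathbb{N}\to\mathbb{N}$; $\{\mathbf{0}\}$ is the ideal consisting of the computable degree only, so $G_{\{\mathbf{0}\}}$ is the subgroup of computable elements of $G$. *)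

theory Defs
  imports
    "HOL-Analysis.Analysis"
    "HOL-Algebra.Bij"
    "HOL-Library.Nat_Bijection"
    "HOL-Library.Sublist"
begin

section \<open>Relative computability and Turing degrees\<close>

text \<open>Unbounded search: the least zero of \<open>p\<close>, defined only if \<open>p\<close> is defined at all
  smaller arguments.\<close>

definition mu_partial :: "(nat \<Rightarrow> nat option) \<Rightarrow> nat option" where
  "mu_partial p =
     (if \<exists>n. p n = Some 0 \<and> (\<forall>m<n. p m \<noteq> None) then Some (LEAST n. p n = Some 0) else None)"

text \<open>The partial functions computable relative to \<open>A\<close>, as the least class containing
  \<open>A\<close> and the initial functions and closed under pairing, composition, primitive recursion and
  unbounded search. All functions are unary; several arguments are passed through the Cantor
  pairing function \<^const>\<open>prod_encode\<close>.\<close>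

inductive partrec_in :: "(nat \<Rightarrow> nat) \<Rightarrow> (nat \<Rightarrow> nat option) \<Rightarrow> bool"
  for A :: "nat \<Rightarrow> nat" where
  query: "partrec_in A (\<lambda>n. Some (A n))"
| zero: "partrec_in A (\<lambda>n. Some 0)"
| succ: "partrec_in A (\<lambda>n. Some (Suc n))"
| left: "partrec_in A (\<lambda>n. Some (fst (prod_decode n)))"
| right: "partrec_in A (\<lambda>n. Some (snd (prod_decode n)))"
| pair: "partrec_in A f \<Longrightarrow> partrec_in A g \<Longrightarrow>
    partrec_in A (\<lambda>n. Option.bind (f n) (\<lambda>a. Option.bind (g n) (\<lambda>b. Some (prod_encode (a, b)))))"
| comp: "partrec_in A f \<Longrightarrow> partrec_in A g \<Longrightarrow> partrec_in A (\<lambda>n. Option.bind (g n) f)"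
| prec: "partrec_in A f \<Longrightarrow> partrec_in A g \<Longrightarrow>
    partrec_in A (\<lambda>n. case prod_decode n of (a, k) \<Rightarrow>
      rec_nat (f a)
        (\<lambda>i r. Option.bind r (\<lambda>v. g (prod_encode (a, prod_encode (i, v))))) k)"
| search: "partrec_in A f \<Longrightarrow>
    partrec_in A (\<lambda>a. mu_partial (\<lambda>k. f (prod_encode (a, k))))"

definition turing_le :: "(nat \<Rightarrow> nat) \<Rightarrow> (nat \<Rightarrow> nat) \<Rightarrow> bool"  (infix \<open>\<le>\<^sub>T\<close> 50) where
  "f \<le>\<^sub>T g \<longleftrightarrow> partrec_in g (\<lambda>n. Some (f n))"

type_synonym turing_degree = "(nat \<Rightarrow> nat) set"

definition turing_deg :: "(nat \<Rightarrow> nat) \<Rightarrow> turing_degree" where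
  "turing_deg f = {g. g \<le>\<^sub>T f \<and> f \<le>\<^sub>T g}"

definition zero_degree :: turing_degree  (\<open>\<zero>\<^sub>T\<close>) where
  "\<zero>\<^sub>T = turing_deg (\<lambda>_. 0)"

text \<open>The degree of \<open>turing_join f g\<close> is the least upper bound of the degrees of \<open>f\<close> and \<open>g\<close>.\<close>

definition turing_join :: "(nat \<Rightarrow> nat) \<Rightarrow> (nat \<Rightarrow> nat) \<Rightarrow> nat \<Rightarrow> nat" where
  "turing_join f g n = (if even n then f (n div 2) else g (n div 2))"


section \<open>Trees of strings and their degree\<close>

text \<open>Strings are coded by the computable bijection \<^const>\<open>list_encode\<close>.\<close>

definition tree_char :: "nat list set \<Rightarrow> nat \<Rightarrow> nat" where
  "tree_char T c = (if list_decode c \<in> T then 1 else 0)"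

definition immediate_succs :: "nat list set \<Rightarrow> nat list \<Rightarrow> nat list set" where
  "immediate_succs T \<sigma> =
     {\<tau> \<in> T. strict_prefix \<sigma> \<tau> \<and> \<not> (\<exists>\<rho>\<in>T. strict_prefix \<sigma> \<rho> \<and> strict_prefix \<rho> \<tau>)}"

text \<open>Meant for finitely branching trees. The value \<open>0\<close> off the tree does not affect the degree
  below, which is joined with that of the tree itself.\<close>

definition branching :: "nat list set \<Rightarrow> nat \<Rightarrow> nat" where
  "branching T c = (if list_decode c \<in> T then card (immediate_succs T (list_decode c)) else 0)"

definition tree_degree :: "nat list set \<Rightarrow> turing_degree" where
  "tree_degree T = turing_deg (turing_join (tree_char T) (branching T))"


section \<open>Subgroups of the group of permutations of the natural numbers\<close>

abbreviation Sinf :: "(nat \<Rightarrow> nat) monoid"  (\<open>S\<^sub>\<infinity>\<close>) where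
  "S\<^sub>\<infinity> \<equiv> BijGroup UNIV"

text \<open>A profinite group is a compact Hausdorff totally disconnected topological group. The topology
  of the type \<^typ>\<open>nat \<Rightarrow> nat\<close> is the product topology for discrete \<^typ>\<open>nat\<close>, i.e. the topology of
  pointwise convergence, in which every subgroup of \<open>S\<^sub>\<infinity>\<close> is a topological group.\<close>

definition profinite_subgroup :: "(nat \<Rightarrow> nat) set \<Rightarrow> bool" where
  "profinite_subgroup G \<longleftrightarrow>
     subgroup G S\<^sub>\<infinity> \<and> compact G \<and> Hausdorff_space (top_of_set G) \<and>
     (\<forall>C\<subseteq>G. connected C \<longrightarrow> (\<exists>g. C \<subseteq> {g}))"

lemma compact_nat_iff_finite: "compact (A :: nat set) \<longleftrightarrow> finite A"
proof
  assume "compact A"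
  then obtain D where "D \<subseteq> A" "finite D" "A \<subseteq> (\<Union>x\<in>D. {x})"
    by (rule compactE_image[where f = "\<lambda>x. {x}" and C = A]) (auto intro: open_discrete)
  then show "finite A"
    by (auto intro: finite_subset)
qed (rule finite_imp_compact)

lemma Hausdorff_Baire_space: "Hausdorff_space (euclidean :: (nat \<Rightarrow> nat) topology)"
proof -
  have "Hausdorff_space (euclidean :: nat topology)"
    unfolding Hausdorff_space_def
  proof (intro allI impI)
    fix x y :: nat
    assume "x \<in> topspace euclidean \<and> y \<in> topspace euclidean \<and> x \<noteq> y"
    then show "\<exists>U V. openin euclidean U \<and> openin euclidean V \<and> x \<in> U \<and> y \<in> V \<and> disjnt U V"
      by (intro exI[of _ "{x}"] exI[of _ "{y}"]) (auto simp: open_discrete)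
  qed
  then show ?thesis
    using Hausdorff_space_product_topology[of "\<lambda>_ :: nat. euclidean :: nat topology" UNIV]
    by (simp add: euclidean_product_topology)
qed

lemma open_agree:
  fixes f :: "nat \<Rightarrow> nat"
  assumes "finite F"
  shows "open {h :: nat \<Rightarrow> nat. \<forall>n\<in>F. h n = f n}"
proof -
  have "open {h :: nat \<Rightarrow> nat. h n = f n}" for n
  proof -
    have "open ((\<lambda>h :: nat \<Rightarrow> nat. h n) -` {f n})"
      by (intro open_vimage open_discrete continuous_on_product_coordinates)
    then show ?thesis
      by (simp add: vimage_def)
  qed
  then have "open (\<Inter>n\<in>F. {h :: nat \<Rightarrow> nat. h n = f n})"
    using assms by blast
  moreover have "(\<Inter>n\<in>F. {h :: nat \<Rightarrow> nat. h n = f n}) = {h. \<forall>n\<in>F. h n = f n}"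
    by auto
  ultimately show ?thesis
    by simp
qed

lemma profinite_subgroup_iff:
  "profinite_subgroup G \<longleftrightarrow>
     subgroup G S\<^sub>\<infinity> \<and> closedin (top_of_set (carrier S\<^sub>\<infinity>)) G \<and> (\<forall>n. finite {g n | g. g \<in> G})"
proof (cases "subgroup G S\<^sub>\<infinity>")
  case G: True
  have sub: "G \<subseteq> carrier S\<^sub>\<infinity>"
    using G by (rule subgroup.subset)
  have carr: "carrier S\<^sub>\<infinity> = {f :: nat \<Rightarrow> nat. bij f}"
    by (auto simp: BijGroup_def Bij_def)
  have td: "\<exists>g. C \<subseteq> {g}" if "connected C" for C :: "(nat \<Rightarrow> nat) set"
  proof -
    have "x = y" if xy: "x \<in> C" "y \<in> C" for x y
    proof
      fix n
      have "connected ((\<lambda>h. h n) ` C)"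
        by (rule connected_continuous_image[OF continuous_on_subset[OF continuous_on_product_coordinates]])
          (use \<open>connected C\<close> in auto)
      moreover have "open ({x n} :: nat set)" "open (- {x n} :: nat set)"
        by (rule open_discrete)+
      ultimately have "{x n} \<inter> (\<lambda>h. h n) ` C = {} \<or> - {x n} \<inter> (\<lambda>h. h n) ` C = {}"
        by (intro connectedD) auto
      moreover have "x n \<in> (\<lambda>h. h n) ` C" "y n \<in> (\<lambda>h. h n) ` C"
        using xy by auto
      ultimately show "x n = y n"
        by (metis ComplI Int_iff empty_iff singletonD singletonI)
    qed
    then show ?thesis
      by blast
  qed
  have "closedin (top_of_set (carrier S\<^sub>\<infinity>)) G \<and> (\<forall>n. finite {g n | g. g \<in> G})" if "compact G"
  proof (intro conjI allI)
    show "closedin (top_of_set (carrier S\<^sub>\<infinity>)) G"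
      using \<open>compact G\<close> sub compactin_imp_closedin[OF Hausdorff_Baire_space, of G]
      by (intro closed_subset) auto
    fix n
    have "compact ((\<lambda>h. h n) ` G)"
      by (rule compact_continuous_image[OF continuous_on_subset[OF continuous_on_product_coordinates]])
        (use \<open>compact G\<close> in auto)
    then show "finite {g n | g. g \<in> G}"
      by (simp add: compact_nat_iff_finite image_def Bex_def conj_commute)
  qed
  moreover have "compact G"
    if cl: "closedin (top_of_set (carrier S\<^sub>\<infinity>)) G" and fin: "\<And>n. finite {g n | g. g \<in> G}"
  proof -
    define P where "P = PiE UNIV (\<lambda>n. {g n | g. g \<in> G})"
    have "compactin (product_topology (\<lambda>_ :: nat. euclidean) UNIV) P"
      unfolding P_def using fin by (simp add: compactin_PiE compact_nat_iff_finite)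
    then have P: "compact P"
      by (simp add: euclidean_product_topology)
    have "closure G \<subseteq> carrier S\<^sub>\<infinity>"
    proof
      fix f assume f: "f \<in> closure G"
      have agree: "\<exists>g\<in>G. \<forall>n\<in>F. g n = f n" if "finite F" for F
      proof -
        have "f \<in> {h. \<forall>n\<in>F. h n = f n} \<inter> closure G"
          using f by simp
        then have "{h. \<forall>n\<in>F. h n = f n} \<inter> G \<noteq> {}"
          using open_Int_closure_eq_empty[OF open_agree[OF that, of f], of G] by fast
        then show ?thesis
          by blast
      qed
      have "inj f"
      proof (rule injI)
        fix x y assume eq: "f x = f y"
        obtain g where "g \<in> G" "g x = f x" "g y = f y"
          using agree[of "{x, y}"] by auto
        then show "x = y"
          using sub carr eq by (metis (mono_tags) bij_is_inj injD mem_Collect_eq subsetD)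
      qed
      moreover have "surj f"
        unfolding surj_def
      proof
        fix y
        obtain g where g: "g \<in> G" "\<forall>n\<in>{h y | h. h \<in> G}. g n = f n"
          using agree[OF fin[of y]] by blast
        have gb: "g \<in> Bij UNIV"
          using g(1) sub by (auto simp: BijGroup_def)
        have "inv\<^bsub>S\<^sub>\<infinity>\<^esub> g \<in> G"
          using G g(1) by (rule subgroup.m_inv_closed)
        then have "inv_into UNIV g \<in> G"
          using gb by (simp add: inv_BijGroup restrict_def)
        then have "g (inv_into UNIV g y) = f (inv_into UNIV g y)"
          using g(2) by blast
        moreover have "g (inv_into UNIV g y) = y"
          using gb by (simp add: Bij_def bij_is_surj surj_f_inv_f)
        ultimately show "\<exists>x. y = f x"
          by metis
      qed
      ultimately show "f \<in> carrier S\<^sub>\<infinity>"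
        by (simp add: carr bij_def)
    qed
    moreover obtain K where K: "closed K" "G = carrier S\<^sub>\<infinity> \<inter> K"
      using cl by (auto simp: closedin_closed)
    moreover have "closure G \<subseteq> K"
      using K by (simp add: closure_minimal)
    ultimately have "closure G \<subseteq> G"
      by blast
    then have "closed G"
      by (metis closure_subset closure_eq subset_antisym)
    moreover have "G \<subseteq> P"
      by (auto simp: P_def)
    ultimately show ?thesis
      using P by (metis compact_Int_closed inf.absorb_iff2)
  qed
  ultimately have "compact G \<longleftrightarrow>
      closedin (top_of_set (carrier S\<^sub>\<infinity>)) G \<and> (\<forall>n. finite {g n | g. g \<in> G})"
    by (intro iffI) (assumption | simp only:)+
  moreover have "profinite_subgroup G \<longleftrightarrow> compact G"
    unfolding profinite_subgroup_def
    using G td Hausdorff_space_subtopology[OF Hausdorff_Baire_space, of G] by simp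
  ultimately show ?thesis
    using G by simp
qed (simp add: profinite_subgroup_def)

definition perm_string :: "(nat \<Rightarrow> nat) \<Rightarrow> nat \<Rightarrow> nat list" where
  "perm_string g n = concat (map (\<lambda>i. [g i, inv_into UNIV g i]) [0..<Suc n])"

definition perm_tree :: "(nat \<Rightarrow> nat) set \<Rightarrow> nat list set" where
  "perm_tree G = {perm_string g n | g n. g \<in> G}"

definition ideal_part :: "(nat \<Rightarrow> nat) set \<Rightarrow> turing_degree set \<Rightarrow> (nat \<Rightarrow> nat) set" where
  "ideal_part G I = {g \<in> G. turing_deg g \<in> I}"


section \<open>First-order formulas in the language of groups\<close>

text \<open>Variables are de Bruijn indices: \<open>\<phi>\<close> is evaluated at a tuple \<open>as\<close>, a quantifier extends the
  tuple at the front.\<close>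

datatype group_term =
  Var nat | Unit | Mult group_term group_term | Inv group_term

datatype group_formula =
  Eq group_term group_term
| Neg group_formula
| Conj group_formula group_formula
| Disj group_formula group_formula
| Exists group_formula
| Forall group_formula

primrec term_vars :: "group_term \<Rightarrow> nat set" where
  "term_vars (Var i) = {i}"
| "term_vars Unit = {}"
| "term_vars (Mult s t) = term_vars s \<union> term_vars t"
| "term_vars (Inv t) = term_vars t"

primrec free_vars :: "group_formula \<Rightarrow> nat set" where
  "free_vars (Eq s t) = term_vars s \<union> term_vars t"
| "free_vars (Neg \<phi>) = free_vars \<phi>"
| "free_vars (Conj \<phi> \<psi>) = free_vars \<phi> \<union> free_vars \<psi>"
| "free_vars (Disj \<phi> \<psi>) = free_vars \<phi> \<union> free_vars \<psi>"
| "free_vars (Exists \<phi>) = {i. Suc i \<in> free_vars \<phi>}"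
| "free_vars (Forall \<phi>) = {i. Suc i \<in> free_vars \<phi>}"

primrec quantifier_free :: "group_formula \<Rightarrow> bool" where
  "quantifier_free (Eq s t) \<longleftrightarrow> True"
| "quantifier_free (Neg \<phi>) \<longleftrightarrow> quantifier_free \<phi>"
| "quantifier_free (Conj \<phi> \<psi>) \<longleftrightarrow> quantifier_free \<phi> \<and> quantifier_free \<psi>"
| "quantifier_free (Disj \<phi> \<psi>) \<longleftrightarrow> quantifier_free \<phi> \<and> quantifier_free \<psi>"
| "quantifier_free (Exists \<phi>) \<longleftrightarrow> False"
| "quantifier_free (Forall \<phi>) \<longleftrightarrow> False"

inductive existential :: "group_formula \<Rightarrow> bool" where
  "quantifier_free \<phi> \<Longrightarrow> existential \<phi>"
| "existential \<phi> \<Longrightarrow> existential (Exists \<phi>)"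

primrec term_val :: "('a, 'b) monoid_scheme \<Rightarrow> 'a list \<Rightarrow> group_term \<Rightarrow> 'a" where
  "term_val H as (Var i) = as ! i"
| "term_val H as Unit = \<one>\<^bsub>H\<^esub>"
| "term_val H as (Mult s t) = term_val H as s \<otimes>\<^bsub>H\<^esub> term_val H as t"
| "term_val H as (Inv t) = inv\<^bsub>H\<^esub> (term_val H as t)"

primrec satisfies :: "('a, 'b) monoid_scheme \<Rightarrow> 'a list \<Rightarrow> group_formula \<Rightarrow> bool" where
  "satisfies H as (Eq s t) \<longleftrightarrow> term_val H as s = term_val H as t"
| "satisfies H as (Neg \<phi>) \<longleftrightarrow> \<not> satisfies H as \<phi>"
| "satisfies H as (Conj \<phi> \<psi>) \<longleftrightarrow> satisfies H as \<phi> \<and> satisfies H as \<psi>"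
| "satisfies H as (Disj \<phi> \<psi>) \<longleftrightarrow> satisfies H as \<phi> \<or> satisfies H as \<psi>"
| "satisfies H as (Exists \<phi>) \<longleftrightarrow> (\<exists>a\<in>carrier H. satisfies H (a # as) \<phi>)"
| "satisfies H as (Forall \<phi>) \<longleftrightarrow> (\<forall>a\<in>carrier H. satisfies H (a # as) \<phi>)"

end

theory Submission
  imports Defs
begin

text \<open>The group is abelian and consists of permutations that rotate each block
  \<open>{4k, \<dots>, 4k + 3}\<close> by some \<open>h k \<in> \<int>/4\<close>, and the formula is \<open>\<exists>x. x x = a\<close>. Block \<open>2e\<close> only admits
  \<open>h (2e) \<in> {0, 2}\<close>, a bit on which squaring loses all information. Block \<open>2c + 1\<close> is tied to
  block \<open>2e\<close> by the condition that \<open>h (2c + 1)\<close> is odd iff \<open>h (2e) = 2\<close>, whenever \<open>c\<close> codes a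
  computation showing that the \<open>e\<close>-th program returns \<open>v \<in> {0, 1}\<close> on input \<open>e\<close>; all other odd
  blocks have even exponent. Since \<open>e \<le> c\<close>, a finite string obeying these conditions always extends,
  and a new block always leaves exactly two choices, so the tree and its branching are computable.

  The computable element \<open>a\<close> rotates block \<open>2c + 1\<close> by \<open>2v\<close>. A square root of \<open>a\<close> must have
  \<open>h (2c + 1) \<equiv> v\<close> modulo 2 and hence \<open>h (2e) = 2v\<close>: it separates the programs that return \<open>0\<close> on
  their own code from those that return \<open>1\<close>. Such a root exists, but none is computable.\<close>

section \<open>Computable functions and decidable predicates\<close>

definition computable :: "(nat \<Rightarrow> nat) \<Rightarrow> bool" where
  "computable f \<longleftrightarrow> f \<le>\<^sub>T (\<lambda>_. 0)"

definition decidable :: "(nat \<Rightarrow> bool) \<Rightarrow> bool" where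
  "decidable P \<longleftrightarrow> computable (\<lambda>x. of_bool (P x))"

named_theorems computable_intros

lemma computable_compose: "computable f \<Longrightarrow> computable g \<Longrightarrow> computable (\<lambda>x. f (g x))"
  using partrec_in.comp[of "\<lambda>_. 0" "\<lambda>x. Some (f x)" "\<lambda>x. Some (g x)"]
  by (simp add: computable_def turing_le_def)

lemma decidable_compose: "decidable P \<Longrightarrow> computable g \<Longrightarrow> decidable (\<lambda>x. P (g x))"
  unfolding decidable_def by (rule computable_compose)

lemma computable_prod_encode [computable_intros]:
  "computable f \<Longrightarrow> computable g \<Longrightarrow> computable (\<lambda>x. prod_encode (f x, g x))"
  using partrec_in.pair[of "\<lambda>_. 0" "\<lambda>x. Some (f x)" "\<lambda>x. Some (g x)"]
  by (simp add: computable_def turing_le_def)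

lemma computable_fst [computable_intros]:
  "computable f \<Longrightarrow> computable (\<lambda>x. fst (prod_decode (f x)))"
  by (rule computable_compose) (auto simp: computable_def turing_le_def intro: partrec_in.left)

lemma computable_snd [computable_intros]:
  "computable f \<Longrightarrow> computable (\<lambda>x. snd (prod_decode (f x)))"
  by (rule computable_compose) (auto simp: computable_def turing_le_def intro: partrec_in.right)

lemma computable_id [computable_intros]: "computable (\<lambda>x. x)"
  using partrec_in.pair[OF partrec_in.left partrec_in.right, of "\<lambda>_. 0"]
  by (simp add: computable_def turing_le_def)

lemma computable_Suc [computable_intros]: "computable f \<Longrightarrow> computable (\<lambda>x. Suc (f x))"
  by (rule computable_compose) (auto simp: computable_def turing_le_def intro: partrec_in.succ)

lemma computable_const [computable_intros]: "computable (\<lambda>x. c)"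
  by (induction c)
    (auto simp: computable_def turing_le_def intro: partrec_in.zero computable_Suc[unfolded computable_def turing_le_def])

text \<open>The third hypothesis packs parameter, counter and previous value into one number, in the
  order used by \<open>partrec_in.prec\<close>.\<close>

lemma computable_rec_nat [computable_intros]:
  assumes "computable f" "computable b"
    and "computable (\<lambda>y. g (fst (prod_decode y)) (fst (prod_decode (snd (prod_decode y))))
           (snd (prod_decode (snd (prod_decode y)))))"
  shows "computable (\<lambda>x. rec_nat (f x) (g x) (b x))"
proof -
  let ?g = "\<lambda>y. g (fst (prod_decode y)) (fst (prod_decode (snd (prod_decode y))))
           (snd (prod_decode (snd (prod_decode y))))"
  have *: "rec_nat (Some (f a)) (\<lambda>i r. Option.bind r (\<lambda>v. Some (?g (prod_encode (a, prod_encode (i, v)))))) k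
     = Some (rec_nat (f a) (g a) k)" for a k
    by (induction k) auto
  have "computable (\<lambda>n. rec_nat (f (fst (prod_decode n))) (g (fst (prod_decode n))) (snd (prod_decode n)))"
    using partrec_in.prec[of "\<lambda>_. 0" "\<lambda>x. Some (f x)" "\<lambda>x. Some (?g x)"] assms
    unfolding * by (simp add: computable_def turing_le_def case_prod_beta)
  from computable_compose[OF this computable_prod_encode[OF computable_id assms(2)]] show ?thesis
    by simp
qed


section \<open>Arithmetic, case distinctions and bounded quantifiers\<close>

lemma computable_add [computable_intros]:
  assumes "computable f" "computable g" shows "computable (\<lambda>x. f x + g x)"
proof -
  have "rec_nat m (\<lambda>_. Suc) n = m + n" for m n
    by (induction n) auto
  then have "(\<lambda>x. f x + g x) = (\<lambda>x. rec_nat (f x) (\<lambda>_. Suc) (g x))"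
    by simp
  then show ?thesis
    by (simp only:) (intro computable_intros assms)
qed

lemma computable_mult [computable_intros]:
  assumes "computable f" "computable g" shows "computable (\<lambda>x. f x * g x)"
proof -
  have "rec_nat 0 (\<lambda>_ r. m + r) n = m * n" for m n :: nat
    by (induction n) auto
  then have "(\<lambda>x. f x * g x) = (\<lambda>x. rec_nat 0 (\<lambda>_ r. f x + r) (g x))"
    by simp
  then show ?thesis
    by (simp only:) (intro computable_intros computable_compose[OF assms(1)] assms)
qed

lemma computable_diff [computable_intros]:
  assumes "computable f" "computable g" shows "computable (\<lambda>x. f x - g x)"
proof -
  have "rec_nat 0 (\<lambda>i _. i) n = n - 1" for n
    by (cases n) auto
  then have "rec_nat m (\<lambda>_ r. rec_nat 0 (\<lambda>i _. i) r) n = m - n" for m n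
    by (induction n) auto
  then have "(\<lambda>x. f x - g x) = (\<lambda>x. rec_nat (f x) (\<lambda>_ r. rec_nat 0 (\<lambda>i _. i) r) (g x))"
    by simp
  then show ?thesis
    by (simp only:) (intro computable_intros assms)
qed

lemma computable_of_bool [computable_intros]:
  "decidable P \<Longrightarrow> computable (\<lambda>x. of_bool (P x))"
  by (simp add: decidable_def)

lemma computable_if [computable_intros]:
  assumes "decidable P" "computable f" "computable g"
  shows "computable (\<lambda>x. if P x then f x else g x)"
proof -
  have "(\<lambda>x. if P x then f x else g x) = (\<lambda>x. rec_nat (g x) (\<lambda>_ _. f x) (of_bool (P x)))"
    by auto
  then show ?thesis
    by (simp only:) (intro computable_intros computable_compose[OF assms(2)] assms)
qed

lemma decidable_le [computable_intros]:
  assumes "computable f" "computable g" shows "decidable (\<lambda>x. f x \<le> g x)"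
proof -
  have "(\<lambda>x. of_bool (f x \<le> g x)) = (\<lambda>x. 1 - (f x - g x))"
    by auto
  then show ?thesis
    unfolding decidable_def by (simp only:) (intro computable_intros assms)
qed

lemma decidable_const [computable_intros]: "decidable (\<lambda>x. c)"
  unfolding decidable_def by (intro computable_intros)

lemma decidable_not [computable_intros]:
  assumes "decidable P" shows "decidable (\<lambda>x. \<not> P x)"
proof -
  have "(\<lambda>x. of_bool (\<not> P x)) = (\<lambda>x. 1 - of_bool (P x) :: nat)"
    by auto
  then show ?thesis
    unfolding decidable_def by (simp only:) (intro computable_intros assms)
qed

lemma decidable_conj [computable_intros]:
  assumes "decidable P" "decidable Q" shows "decidable (\<lambda>x. P x \<and> Q x)"
proof -
  have "(\<lambda>x. of_bool (P x \<and> Q x)) = (\<lambda>x. of_bool (P x) * of_bool (Q x) :: nat)"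
    by auto
  then show ?thesis
    unfolding decidable_def by (simp only:) (intro computable_intros assms)
qed

lemma decidable_disj [computable_intros]:
  assumes "decidable P" "decidable Q" shows "decidable (\<lambda>x. P x \<or> Q x)"
  using decidable_not[OF decidable_conj[OF assms[THEN decidable_not]]] by simp

lemma decidable_imp [computable_intros]:
  assumes "decidable P" "decidable Q" shows "decidable (\<lambda>x. P x \<longrightarrow> Q x)"
  using decidable_disj[OF decidable_not[OF assms(1)] assms(2)] by (simp only: imp_conv_disj)

lemma decidable_if [computable_intros]:
  assumes "decidable P" "decidable Q" "decidable R"
  shows "decidable (\<lambda>x. if P x then Q x else R x)"
proof -
  have "(\<lambda>x. if P x then Q x else R x) = (\<lambda>x. P x \<and> Q x \<or> \<not> P x \<and> R x)"
    by auto
  then show ?thesis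
    by (simp only:) (intro computable_intros assms)
qed

lemma decidable_less [computable_intros]:
  assumes "computable f" "computable g" shows "decidable (\<lambda>x. f x < g x)"
  using decidable_le[OF computable_Suc[OF assms(1)] assms(2)] by (simp add: Suc_le_eq)

lemma decidable_eq [computable_intros]:
  fixes f g :: "nat \<Rightarrow> nat"
  assumes "computable f" "computable g" shows "decidable (\<lambda>x. f x = g x)"
  using decidable_conj[OF decidable_le[OF assms] decidable_le[OF assms(2,1)]] by (simp add: eq_iff)

lemma decidable_bounded_all [computable_intros]:
  assumes "computable b" "decidable (\<lambda>y. P (fst (prod_decode y)) (snd (prod_decode y)))"
  shows "decidable (\<lambda>x. \<forall>i<b x. P x i)"
proof -
  have "rec_nat 1 (\<lambda>i r. r * of_bool (P x i)) n = (of_bool (\<forall>i<n. P x i) :: nat)" for x n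
    by (induction n) (auto simp: less_Suc_eq)
  then have *: "(\<lambda>x. of_bool (\<forall>i<b x. P x i)) = (\<lambda>x. rec_nat 1 (\<lambda>i r. r * of_bool (P x i)) (b x) :: nat)"
    by simp
  have "decidable (\<lambda>y. P (fst (prod_decode y)) (fst (prod_decode (snd (prod_decode y)))))"
    using decidable_compose[OF assms(2) computable_prod_encode[OF computable_fst[OF computable_id]
          computable_fst[OF computable_snd[OF computable_id]]]] by simp
  then show ?thesis
    unfolding decidable_def * by (intro computable_intros assms) (simp_all add: decidable_def)
qed

lemma decidable_bounded_ex [computable_intros]:
  assumes "computable b" "decidable (\<lambda>y. P (fst (prod_decode y)) (snd (prod_decode y)))"
  shows "decidable (\<lambda>x. \<exists>i<b x. P x i)"
  using decidable_not[OF decidable_bounded_all[OF assms(1) decidable_not[OF assms(2)]]] by simp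

text \<open>Since \<open>f\<close> is total, the search for the value in its graph always halts.
  This serves functions that are easier to specify by a decidable relation than by a recursion, such
  as division and length.\<close>

lemma computable_if_decidable_graph:
  assumes "decidable (\<lambda>y. snd (prod_decode y) = f (fst (prod_decode y)))"
  shows "computable f"
proof -
  have "mu_partial (\<lambda>k. Some (of_bool (k \<noteq> f a))) = Some (f a)" for a
    unfolding mu_partial_def by (auto intro: Least_equality)
  then show ?thesis
    using partrec_in.search[of "\<lambda>_. 0" "\<lambda>y. Some (of_bool (snd (prod_decode y) \<noteq> f (fst (prod_decode y))))"]
      decidable_not[OF assms]
    by (simp add: decidable_def computable_def turing_le_def)
qed

lemma computable_div [computable_intros]:
  assumes "computable f" "computable g" shows "computable (\<lambda>x. f x div g x)"
proof (rule computable_if_decidable_graph)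
  \<comment> \<open>The quotient is pinned down by two inequalities; the divisor 0 is separate
    because \<open>m div 0 = 0\<close>.\<close>
  have "y = m div n \<longleftrightarrow> n = 0 \<and> y = 0 \<or> n * y \<le> m \<and> m < n * Suc y" for y m n :: nat
    by (cases "n = 0") (auto simp: dividend_less_times_div intro!: div_nat_eqI[symmetric])
  then have *: "(\<lambda>y. snd (prod_decode y) = f (fst (prod_decode y)) div g (fst (prod_decode y))) =
    (\<lambda>y. g (fst (prod_decode y)) = 0 \<and> snd (prod_decode y) = 0 \<or>
      g (fst (prod_decode y)) * snd (prod_decode y) \<le> f (fst (prod_decode y)) \<and>
      f (fst (prod_decode y)) < g (fst (prod_decode y)) * Suc (snd (prod_decode y)))"
    by (simp only:)
  show "decidable (\<lambda>y. snd (prod_decode y) = f (fst (prod_decode y)) div g (fst (prod_decode y)))"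
    unfolding * by (intro computable_intros assms[THEN computable_compose])
qed

lemma computable_mod [computable_intros]:
  assumes "computable f" "computable g" shows "computable (\<lambda>x. f x mod g x)"
  unfolding modulo_nat_def by (intro computable_intros assms)

lemma computable_funpow [computable_intros]:
  assumes "computable f" "computable n" "computable g"
  shows "computable (\<lambda>x. (f ^^ n x) (g x))"
proof -
  have "(f ^^ k) y = rec_nat y (\<lambda>_. f) k" for k y
    by (induction k) auto
  then show ?thesis
    by (simp only:) (intro computable_intros computable_compose[OF assms(1)] assms)
qed

section \<open>Turing reductions and the computable degree\<close>

lemma partrec_in_trans:
  assumes "partrec_in A f" "A \<le>\<^sub>T B" shows "partrec_in B f"
  using assms(1)
proof induction
  case query
  then show ?case using assms(2) by (simp add: turing_le_def)
qed (rule partrec_in.intros; assumption)+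

lemma turing_deg_eq_zero_iff: "turing_deg f = \<zero>\<^sub>T \<longleftrightarrow> computable f"
proof
  assume "turing_deg f = \<zero>\<^sub>T"
  moreover have "f \<in> turing_deg f"
    by (simp add: turing_deg_def turing_le_def partrec_in.query)
  ultimately show "computable f"
    by (simp add: zero_degree_def turing_deg_def computable_def)
next
  assume "computable f"
  moreover have "(\<lambda>_. 0) \<le>\<^sub>T f"
    by (simp add: turing_le_def partrec_in.zero)
  ultimately show "turing_deg f = \<zero>\<^sub>T"
    unfolding zero_degree_def turing_deg_def computable_def turing_le_def
    by (blast intro: partrec_in_trans[unfolded turing_le_def])
qed

lemma computable_turing_join:
  assumes "computable f" "computable g" shows "computable (turing_join f g)"
proof -
  have "turing_join f g = (\<lambda>n. if n mod 2 = 0 then f (n div 2) else g (n div 2))"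
    by (auto simp: turing_join_def even_iff_mod_2_eq_zero)
  then show ?thesis
    by (simp only:) (intro computable_intros assms[THEN computable_compose])
qed

section \<open>Coded lists\<close>

text \<open>A nonempty list \<open>x # xs\<close> has code
  \<open>Suc (prod_encode (x, list_encode xs))\<close> and the empty list has code 0, so subtracting
  1 exposes head and tail.\<close>

definition list_hd :: "nat \<Rightarrow> nat" where
  "list_hd c = fst (prod_decode (c - 1))"

definition list_tl :: "nat \<Rightarrow> nat" where
  "list_tl c = snd (prod_decode (c - 1))"

lemma computable_list_hd [computable_intros]: "computable f \<Longrightarrow> computable (\<lambda>x. list_hd (f x))"
  unfolding list_hd_def by (intro computable_intros)

lemma computable_list_tl: "computable list_tl"
  unfolding list_tl_def by (intro computable_intros)

lemmas computable_drop [computable_intros] = computable_funpow[OF computable_list_tl]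

lemma list_decode_nonzero: "c \<noteq> 0 \<Longrightarrow> list_decode c = list_hd c # list_decode (list_tl c)"
  by (cases c) (auto simp: list_hd_def list_tl_def case_prod_beta)

text \<open>Truncated subtraction leads to \<open>prod_decode 0 = (0, 0)\<close>, so taking tails
  beyond the end of a list stays at the empty list, as \<open>drop\<close> does.\<close>

lemma list_tl_0 [simp]: "list_tl 0 = 0"
proof -
  have "prod_decode 0 = (0, 0)"
    using prod_encode_inverse[of "(0, 0)"] by (simp add: prod_encode_def)
  then show ?thesis
    by (simp add: list_tl_def)
qed

lemma list_decode_list_tl: "list_decode (list_tl c) = tl (list_decode c)"
  by (cases "c = 0") (simp_all add: list_decode_nonzero)

lemma list_decode_drop: "list_decode ((list_tl ^^ i) c) = drop i (list_decode c)"
  by (induction i) (simp_all add: list_decode_list_tl drop_Suc tl_drop)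

lemma list_decode_eq_Nil_iff: "list_decode c = [] \<longleftrightarrow> c = 0"
  by (cases "c = 0") (simp_all add: list_decode_nonzero)

lemma drop_nonzero_iff: "(list_tl ^^ i) c \<noteq> 0 \<longleftrightarrow> i < length (list_decode c)"
  using list_decode_eq_Nil_iff[of "(list_tl ^^ i) c"] by (auto simp: list_decode_drop)

lemma list_hd_drop: "i < length (list_decode c) \<Longrightarrow> list_hd ((list_tl ^^ i) c) = list_decode c ! i"
  using list_decode_nonzero[of "(list_tl ^^ i) c"]
  by (simp add: drop_nonzero_iff[simplified] list_decode_drop flip: Cons_nth_drop_Suc)

text \<open>Together with \<open>mem_less_list_encode\<close> this turns searches through the
  positions or entries of a coded list into searches bounded by the code.\<close>

lemma length_le_list_encode: "length xs \<le> list_encode xs"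
  by (induction xs) (auto intro: le_trans[OF _ le_prod_encode_2])

lemma length_list_decode_le: "length (list_decode c) \<le> c"
  using length_le_list_encode[of "list_decode c"] by simp

lemma mem_less_list_encode: "x \<in> set xs \<Longrightarrow> x < list_encode xs"
proof (induction xs)
  case (Cons a xs)
  then show ?case
    using le_prod_encode_1[of a "list_encode xs"] le_prod_encode_2[of "list_encode xs" a] by auto
qed simp

lemma mem_list_decode_less: "x \<in> set (list_decode c) \<Longrightarrow> x < c"
  using mem_less_list_encode[of x "list_decode c"] by simp

lemma decidable_mem_list_decode [computable_intros]:
  assumes "computable f" "computable g"
  shows "decidable (\<lambda>x. f x \<in> set (list_decode (g x)))"
proof -
  have "t \<in> set (list_decode c) \<longleftrightarrow> (\<exists>i<c. (list_tl ^^ i) c \<noteq> 0 \<and> list_hd ((list_tl ^^ i) c) = t)" for t c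
    unfolding in_set_conv_nth drop_nonzero_iff
    using length_list_decode_le[of c] list_hd_drop[of _ c] by (metis order_less_le_trans)
  then show ?thesis
    by (simp only:) (intro computable_intros assms[THEN computable_compose])
qed

lemma computable_length_list_decode [computable_intros]:
  assumes "computable f" shows "computable (\<lambda>x. length (list_decode (f x)))"
proof (rule computable_if_decidable_graph)
  have eq: "m = length (list_decode c) \<longleftrightarrow> (list_tl ^^ m) c = 0 \<and> (\<forall>i<m. (list_tl ^^ i) c \<noteq> 0)" for m c
    using drop_nonzero_iff[of _ c] by (metis less_irrefl linorder_neqE_nat)
  show "decidable (\<lambda>y. snd (prod_decode y) = length (list_decode (f (fst (prod_decode y)))))"
    unfolding eq by (intro computable_intros assms[THEN computable_compose])
qed

section \<open>Computations as coded derivations\<close>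

text \<open>\<open>fact_code e x v\<close> stands for the claim that program \<open>e\<close> returns \<open>v\<close> on input \<open>x\<close>. A program
  is \<open>prog_code k f g\<close>, where \<open>k\<close> selects a clause of \<^const>\<open>partrec_in\<close> and \<open>f\<close>, \<open>g\<close> are the
  programs it refers to. As the oracle is constantly \<open>0\<close>, queries share a clause with the zero
  function. Checking a list of claims, each following from later ones in one step, needs
  only bounded quantifiers, which avoids programming a universal machine.\<close>

definition fact_code :: "nat \<Rightarrow> nat \<Rightarrow> nat \<Rightarrow> nat" where
  "fact_code e x v = prod_encode (e, prod_encode (x, v))"

definition prog_code :: "nat \<Rightarrow> nat \<Rightarrow> nat \<Rightarrow> nat" where
  "prog_code k f g = prod_encode (k, prod_encode (f, g))"

definition prog_op :: "nat \<Rightarrow> nat" where "prog_op e = fst (prod_decode e)"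
definition prog_arg1 :: "nat \<Rightarrow> nat" where "prog_arg1 e = fst (prod_decode (snd (prod_decode e)))"
definition prog_arg2 :: "nat \<Rightarrow> nat" where "prog_arg2 e = snd (prod_decode (snd (prod_decode e)))"

lemma prog_code_simps [simp]:
  "prog_op (prog_code k f g) = k" "prog_arg1 (prog_code k f g) = f" "prog_arg2 (prog_code k f g) = g"
  by (simp_all add: prog_op_def prog_arg1_def prog_arg2_def prog_code_def)

text \<open>Operations 0 to 3 are the initial functions, 4 is pairing, 5 composition, 6 primitive
  recursion, and every larger number is unbounded search. In the search clause the earlier values
  must be successors, that is, defined and nonzero.\<close>

definition justified :: "nat set \<Rightarrow> nat \<Rightarrow> nat \<Rightarrow> nat \<Rightarrow> bool" where
  "justified S e x v \<longleftrightarrow>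
    (if prog_op e = 0 then v = 0
     else if prog_op e = 1 then v = Suc x
     else if prog_op e = 2 then v = fst (prod_decode x)
     else if prog_op e = 3 then v = snd (prod_decode x)
     else if prog_op e = 4 then
       fact_code (prog_arg1 e) x (fst (prod_decode v)) \<in> S \<and>
       fact_code (prog_arg2 e) x (snd (prod_decode v)) \<in> S
     else if prog_op e = 5 then
       (\<exists>y. fact_code (prog_arg2 e) x y \<in> S \<and> fact_code (prog_arg1 e) y v \<in> S)
     else if prog_op e = 6 then
       (if snd (prod_decode x) = 0 then fact_code (prog_arg1 e) (fst (prod_decode x)) v \<in> S
        else \<exists>r. fact_code e (prod_encode (fst (prod_decode x), snd (prod_decode x) - 1)) r \<in> S \<and>
          fact_code (prog_arg2 e)
            (prod_encode (fst (prod_decode x), prod_encode (snd (prod_decode x) - 1, r))) v \<in> S)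
     else fact_code (prog_arg1 e) (prod_encode (x, v)) 0 \<in> S \<and>
       (\<forall>m<v. \<exists>r. fact_code (prog_arg1 e) (prod_encode (x, m)) (Suc r) \<in> S))"

lemma justified_mono: "justified S e x v \<Longrightarrow> S \<subseteq> S' \<Longrightarrow> justified S' e x v"
  unfolding justified_def by (auto split: if_splits) (blast | meson subsetD)+

text \<open>Each clause determines the value from its premises. Two sets are allowed because the
  claims will come from different derivations.\<close>

lemma justified_deterministic:
  assumes "justified S e x v" "justified S' e x v'"
    and S: "\<And>e x v v'. fact_code e x v \<in> S \<Longrightarrow> fact_code e x v' \<in> S' \<Longrightarrow> v = v'"
  shows "v = v'"
proof -
  consider "prog_op e < 4" | "prog_op e = 4" | "prog_op e = 5" | "prog_op e = 6" | "prog_op e > 6"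
    by linarith
  then show ?thesis
  proof cases
    case 1
    then show ?thesis
      using assms(1,2) by (auto simp: justified_def split: if_splits)
  next
    case 2
    then have "fst (prod_decode v) = fst (prod_decode v')" "snd (prod_decode v) = snd (prod_decode v')"
      using assms(1,2) by (auto simp: justified_def intro: S)
    then show ?thesis
      by (metis prod_eq_iff prod_decode_eq)
  next
    case 3
    then show ?thesis
      using assms(1,2) S unfolding justified_def by simp metis
  next
    case 4
    then show ?thesis
      using assms(1,2) S unfolding justified_def by (simp split: if_splits) metis+
  next
    case 5
    define f where "f m = fact_code (prog_arg1 e) (prod_encode (x, m))" for m
    have "f v 0 \<in> S" "f v' 0 \<in> S'" "\<And>m. m < v \<Longrightarrow> \<exists>r. f m (Suc r) \<in> S"
      "\<And>m. m < v' \<Longrightarrow> \<exists>r. f m (Suc r) \<in> S'"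
      using 5 assms(1,2) by (auto simp: justified_def f_def)
    moreover have "a = b" if "f m a \<in> S" "f m b \<in> S'" for m a b
      using that S by (auto simp: f_def)
    \<comment> \<open>If \<open>v < v'\<close>, the second search has a successor value at
      \<open>v\<close> where the first has 0; symmetrically for \<open>v' < v\<close>.\<close>
    ultimately show ?thesis
      by (metis nat.distinct(1) nat_neq_iff)
  qed
qed

section \<open>Derivations and the facts they prove\<close>

primrec derivation :: "nat list \<Rightarrow> bool" where
  "derivation [] \<longleftrightarrow> True"
| "derivation (t # d) \<longleftrightarrow>
    (\<exists>e x v. t = fact_code e x v \<and> justified (set d) e x v) \<and> derivation d"

definition derivable :: "nat set" where
  "derivable = (\<Union>d\<in>{d. derivation d}. set d)"

lemma fact_code_eq_iff [simp]:
  "fact_code e x v = fact_code e' x' v' \<longleftrightarrow> e = e' \<and> x = x' \<and> v = v'"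
  by (simp add: fact_code_def prod_encode_eq)

lemma derivation_append: "derivation d \<Longrightarrow> derivation d' \<Longrightarrow> derivation (d @ d')"
  by (induction d) (auto intro!: justified_mono)

lemma finite_subset_derivation:
  "finite F \<Longrightarrow> F \<subseteq> derivable \<Longrightarrow> \<exists>d. derivation d \<and> F \<subseteq> set d"
proof (induction F rule: finite_induct)
  case empty
  then show ?case by (auto intro: exI[of _ "[]"])
next
  case (insert t F)
  then obtain d d' where "derivation d" "F \<subseteq> set d" "derivation d'" "t \<in> set d'"
    by (auto simp: derivable_def)
  then show ?case
    by (intro exI[of _ "d @ d'"]) (auto intro: derivation_append)
qed

text \<open>A single step uses only finitely many premises, even in the search clause, where they
  are indexed by the numbers up to \<open>v\<close>. Hence one derivation contains all of them, and
  the new claim can be put in front.\<close>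

lemma derivableI:
  assumes "justified derivable e x v" shows "fact_code e x v \<in> derivable"
proof -
  consider "prog_op e < 4" | "prog_op e = 4" | "prog_op e = 5" | "prog_op e = 6" | "prog_op e > 6"
    by linarith
  then have "\<exists>F. finite F \<and> F \<subseteq> derivable \<and> justified F e x v"
  proof cases
    case 1
    then show ?thesis
      using assms by (intro exI[of _ "{}"]) (auto simp: justified_def split: if_splits)
  next
    case 2
    then show ?thesis
      using assms unfolding justified_def
      by (intro exI[of _ "{fact_code (prog_arg1 e) x (fst (prod_decode v)),
          fact_code (prog_arg2 e) x (snd (prod_decode v))}"]) auto
  next
    case 3
    then obtain y where "fact_code (prog_arg2 e) x y \<in> derivable" "fact_code (prog_arg1 e) y v \<in> derivable"
      using assms by (auto simp: justified_def)
    then show ?thesis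
      using 3 unfolding justified_def
      by (intro exI[of _ "{fact_code (prog_arg2 e) x y, fact_code (prog_arg1 e) y v}"]) auto
  next
    case 4
    show ?thesis
    proof (cases "snd (prod_decode x) = 0")
      case True
      then show ?thesis
        using 4 assms unfolding justified_def
        by (intro exI[of _ "{fact_code (prog_arg1 e) (fst (prod_decode x)) v}"]) auto
    next
      case False
      then obtain r where "fact_code e (prod_encode (fst (prod_decode x), snd (prod_decode x) - 1)) r \<in> derivable"
          "fact_code (prog_arg2 e)
            (prod_encode (fst (prod_decode x), prod_encode (snd (prod_decode x) - 1, r))) v \<in> derivable"
        using 4 assms by (auto simp: justified_def)
      then show ?thesis
        using 4 False unfolding justified_def
        by (intro exI[of _ "{fact_code e (prod_encode (fst (prod_decode x), snd (prod_decode x) - 1)) r,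
          fact_code (prog_arg2 e)
            (prod_encode (fst (prod_decode x), prod_encode (snd (prod_decode x) - 1, r))) v}"]) auto
    qed
  next
    case 5
    then obtain r where "\<And>m. m < v \<Longrightarrow> fact_code (prog_arg1 e) (prod_encode (x, m)) (Suc (r m)) \<in> derivable"
        "fact_code (prog_arg1 e) (prod_encode (x, v)) 0 \<in> derivable"
      using assms by (auto simp: justified_def) metis
    then show ?thesis
      using 5 unfolding justified_def
      by (intro exI[of _ "insert (fact_code (prog_arg1 e) (prod_encode (x, v)) 0)
        ((\<lambda>m. fact_code (prog_arg1 e) (prod_encode (x, m)) (Suc (r m))) ` {..<v})"]) auto
  qed
  then obtain d where "derivation d" "justified (set d) e x v"
    using finite_subset_derivation justified_mono by metis
  then have "derivation (fact_code e x v # d)"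
    by auto
  then show ?thesis
    unfolding derivable_def by (intro UN_I[of "fact_code e x v # d"]) simp_all
qed

lemma derivation_deterministic:
  "derivation d \<Longrightarrow> derivation d' \<Longrightarrow> fact_code e x v \<in> set d \<Longrightarrow> fact_code e x v' \<in> set d' \<Longrightarrow> v = v'"
proof (induction d arbitrary: d' e x v v')
  case (Cons t d)
  \<comment> \<open>A claim is justified by the entries after it, hence by monotonicity by the whole
    list.\<close>
  have inv: "justified (set d') e x v'" if "derivation d'" "fact_code e x v' \<in> set d'" for d'
    using that by (induction d') (auto intro: justified_mono)
  show ?case
  proof (cases "fact_code e x v \<in> set d")
    case True
    then show ?thesis using Cons by auto
  next
    case False
    then have "justified (set d) e x v"
      using Cons.prems by auto
    then show ?thesis
      by (rule justified_deterministic[OF _ inv[OF Cons.prems(2,4)]])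
        (use Cons in auto)
  qed
qed simp

text \<open>Each clause of \<open>partrec_in\<close> is matched by a program operation applied to
  the programs from the induction hypotheses.\<close>

lemma partrec_derivable:
  assumes "partrec_in (\<lambda>_. 0) f"
  shows "\<exists>e. \<forall>x v. f x = Some v \<longrightarrow> fact_code e x v \<in> derivable"
  using assms
proof induction
  case query
  show ?case
    by (intro exI[of _ "prog_code 0 0 0"]) (auto intro!: derivableI simp: justified_def)
next
  case zero
  show ?case
    by (intro exI[of _ "prog_code 0 0 0"]) (auto intro!: derivableI simp: justified_def)
next
  case succ
  show ?case
    by (intro exI[of _ "prog_code 1 0 0"]) (auto intro!: derivableI simp: justified_def)
next
  case left
  show ?case
    by (intro exI[of _ "prog_code 2 0 0"]) (auto intro!: derivableI simp: justified_def)
next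
  case right
  show ?case
    by (intro exI[of _ "prog_code 3 0 0"]) (auto intro!: derivableI simp: justified_def)
next
  case (pair f g)
  then obtain a b where "\<And>x v. f x = Some v \<Longrightarrow> fact_code a x v \<in> derivable"
      "\<And>x v. g x = Some v \<Longrightarrow> fact_code b x v \<in> derivable"
    by blast
  then show ?case
    by (intro exI[of _ "prog_code 4 a b"])
      (auto intro!: derivableI simp: justified_def bind_eq_Some_conv)
next
  case (comp f g)
  then obtain a b where "\<And>x v. f x = Some v \<Longrightarrow> fact_code a x v \<in> derivable"
      "\<And>x v. g x = Some v \<Longrightarrow> fact_code b x v \<in> derivable"
    by blast
  then show ?case
    by (intro exI[of _ "prog_code 5 a b"])
      (auto intro!: derivableI simp: justified_def bind_eq_Some_conv, blast)
next
  case (prec f g)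
  then obtain a b where ab: "\<And>x v. f x = Some v \<Longrightarrow> fact_code a x v \<in> derivable"
      "\<And>x v. g x = Some v \<Longrightarrow> fact_code b x v \<in> derivable"
    by blast
  have *: "fact_code (prog_code 6 a b) (prod_encode (x, k)) v \<in> derivable"
    if "rec_nat (f x) (\<lambda>i r. Option.bind r (\<lambda>v. g (prod_encode (x, prod_encode (i, v))))) k = Some v"
    for x k v
    using that
  proof (induction k arbitrary: v)
    case 0
    then show ?case
      using ab(1) by (auto intro!: derivableI simp: justified_def)
  next
    case (Suc k)
    then obtain r where
      "rec_nat (f x) (\<lambda>i r. Option.bind r (\<lambda>v. g (prod_encode (x, prod_encode (i, v))))) k = Some r"
      "g (prod_encode (x, prod_encode (k, r))) = Some v"
      by (auto simp: bind_eq_Some_conv)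
    then have "fact_code (prog_code 6 a b) (prod_encode (x, k)) r \<in> derivable"
      "fact_code b (prod_encode (x, prod_encode (k, r))) v \<in> derivable"
      using Suc.IH ab(2) by auto
    then show ?case
      by (auto intro!: derivableI simp: justified_def) blast
  qed
  show ?case
    using *[of "fst (prod_decode x)" "snd (prod_decode x)" for x]
    by (intro exI[of _ "prog_code 6 a b"]) (simp add: case_prod_beta)
next
  case (search f)
  then obtain a where a: "\<And>x v. f x = Some v \<Longrightarrow> fact_code a x v \<in> derivable"
    by blast
  have "fact_code (prog_code 7 a 0) x v \<in> derivable"
    if mu: "mu_partial (\<lambda>k. f (prod_encode (x, k))) = Some v" for x v
  proof (rule derivableI)
    let ?p = "\<lambda>k. f (prod_encode (x, k))"
    obtain n where n: "?p n = Some 0" "\<forall>m<n. ?p m \<noteq> None" "v = (LEAST n. ?p n = Some 0)"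
      using mu by (auto simp: mu_partial_def split: if_splits)
    have "?p v = Some 0" "v \<le> n"
      using n(1) unfolding n(3) by (auto intro: LeastI[of "\<lambda>n. ?p n = Some 0"] Least_le)
    \<comment> \<open>Below the least zero the values are not 0 by minimality, and they are defined
      because \<open>v \<le> n\<close>.\<close>
    moreover have "\<exists>r. ?p m = Some (Suc r)" if m: "m < v" for m
    proof -
      have "?p m \<noteq> Some 0"
        using not_less_Least[of m "\<lambda>n. ?p n = Some 0"] m unfolding n(3) by simp
      moreover obtain r where "?p m = Some r"
        using n(2) m \<open>v \<le> n\<close> by fastforce
      ultimately show ?thesis
        by (cases r) auto
    qed
    ultimately show "justified derivable (prog_code 7 a 0) x v"
      using a by (auto simp: justified_def) metis
  qed
  then show ?case
    by blast
qed

section \<open>Decidability of being a derivation\<close>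

lemma decidable_justified [computable_intros]:
  assumes c: "computable c" "computable e" "computable x" "computable v"
  shows "decidable (\<lambda>n. justified (set (list_decode (c n))) (e n) (x n) (v n))"
proof -
  \<comment> \<open>A claim in the list is smaller than the list code and at least as large as its
    value, so the quantifiers over intermediate values can be bounded by the code.\<close>
  have less: "v < c" if "fact_code e x v \<in> set (list_decode c)" for e x v c
    using mem_list_decode_less[OF that] le_prod_encode_2[of v x] le_prod_encode_2[of "prod_encode (x, v)" e]
    by (simp add: fact_code_def)
  have bounded: "(\<exists>v. fact_code e x v \<in> set (list_decode c) \<and> P v) \<longleftrightarrow>
      (\<exists>v<c. fact_code e x v \<in> set (list_decode c) \<and> P v)" for e x c P
    using less by blast
  have bounded': "(\<exists>v. fact_code e x (Suc v) \<in> set (list_decode c)) \<longleftrightarrow>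
      (\<exists>v<c. fact_code e x (Suc v) \<in> set (list_decode c))" for e x c
    using less by (meson Suc_lessD)
  show ?thesis
    unfolding justified_def bounded bounded' unfolding fact_code_def prog_op_def prog_arg1_def prog_arg2_def
    by (intro computable_intros assms[THEN computable_compose])
qed

lemma derivation_iff:
  "derivation d \<longleftrightarrow> (\<forall>i<length d. justified (set (drop (Suc i) d)) (fst (prod_decode (d ! i)))
     (fst (prod_decode (snd (prod_decode (d ! i))))) (snd (prod_decode (snd (prod_decode (d ! i))))))"
proof (induction d)
  case (Cons t d)
  have "(\<exists>e x v. t = fact_code e x v \<and> justified (set d) e x v) \<longleftrightarrow>
    justified (set d) (fst (prod_decode t))
     (fst (prod_decode (snd (prod_decode t)))) (snd (prod_decode (snd (prod_decode t))))"
    unfolding fact_code_def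
    by (metis fst_conv snd_conv prod.collapse prod_decode_inverse prod_encode_inverse)
  with Cons show ?case
    by (auto simp: less_Suc_eq_0_disj)
qed simp

lemma decidable_derivation [computable_intros]:
  assumes "computable f" shows "decidable (\<lambda>x. derivation (list_decode (f x)))"
proof -
  define H where "H i c = list_hd ((list_tl ^^ i) c)" for i c
  have [computable_intros]: "computable f \<Longrightarrow> computable g \<Longrightarrow> computable (\<lambda>x. H (f x) (g x))" for f g
    unfolding H_def by (intro computable_intros)
  have "derivation (list_decode c) \<longleftrightarrow> (\<forall>i<c. (list_tl ^^ i) c \<noteq> 0 \<longrightarrow>
     justified (set (list_decode ((list_tl ^^ Suc i) c))) (fst (prod_decode (H i c)))
       (fst (prod_decode (snd (prod_decode (H i c)))))
       (snd (prod_decode (snd (prod_decode (H i c))))))" for c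
    unfolding derivation_iff list_decode_drop drop_nonzero_iff H_def
    using length_list_decode_le[of c] by (auto simp: list_hd_drop)
  then show ?thesis
    by (simp only:) (intro computable_intros assms[THEN computable_compose])
qed

section \<open>Stages: derivations of bits on the diagonal\<close>

definition stage_index :: "nat \<Rightarrow> nat" where
  "stage_index c = fst (prod_decode (list_hd c))"

definition stage_value :: "nat \<Rightarrow> nat" where
  "stage_value c = snd (prod_decode (snd (prod_decode (list_hd c))))"

text \<open>Program and input of the leading claim coincide. As \<open>list_hd 0\<close> is 0, a
  claim code that no entry of the empty list backs, \<open>c \<noteq> 0\<close> is required.\<close>

definition stage :: "nat \<Rightarrow> bool" where
  "stage c \<longleftrightarrow> c \<noteq> 0 \<and> derivation (list_decode c) \<and>
     list_hd c = fact_code (stage_index c) (stage_index c) (stage_value c) \<and> stage_value c \<le> 1"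

lemma computable_stage_index [computable_intros]:
  "computable f \<Longrightarrow> computable (\<lambda>x. stage_index (f x))"
  unfolding stage_index_def by (intro computable_intros)

lemma computable_stage_value [computable_intros]:
  "computable f \<Longrightarrow> computable (\<lambda>x. stage_value (f x))"
  unfolding stage_value_def by (intro computable_intros)

lemma decidable_stage [computable_intros]:
  "computable f \<Longrightarrow> decidable (\<lambda>x. stage (f x))"
  unfolding stage_def fact_code_def by (intro computable_intros)

text \<open>The index is a component of the head entry, and entries are smaller than the list code.
  This places block \<open>2 * stage_index c\<close> before block \<open>2 * c + 1\<close>.\<close>

lemma stage_index_less: "stage c \<Longrightarrow> stage_index c < c"
  using le_prod_encode_1[of "stage_index c"] mem_list_decode_less[of "list_hd c" c] list_decode_nonzero[of c]
  by (fastforce simp: stage_def fact_code_def intro: le_less_trans)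

text \<open>Different stages for one program impose the same bit on its even block, so the
  conditions on a square root are consistent.\<close>

lemma stage_value_unique:
  assumes "stage c" "stage c'" "stage_index c = stage_index c'"
  shows "stage_value c = stage_value c'"
  using derivation_deterministic[of "list_decode c" "list_decode c'" "stage_index c" "stage_index c"
      "stage_value c" "stage_value c'"] assms list_decode_nonzero[of c] list_decode_nonzero[of c']
  by (auto simp: stage_def)

text \<open>Diagonalisation: a program for \<open>f\<close> is run on its own code.\<close>

lemma exists_stage:
  assumes "computable f" "\<And>n. f n \<le> 1"
  shows "\<exists>c. stage c \<and> stage_value c = f (stage_index c)"
proof -
  obtain e where "fact_code e e (f e) \<in> derivable"
    using partrec_derivable[of "\<lambda>n. Some (f n)"] assms(1) by (auto simp: computable_def turing_le_def)
  then obtain d where d: "derivation d" "fact_code e e (f e) \<in> set d"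
    by (auto simp: derivable_def)
  then obtain d1 d2 where "d = d1 @ fact_code e e (f e) # d2"
    by (meson split_list)
  \<comment> \<open>Dropping the entries before the chosen claim leaves a derivation with that claim
    at its head.\<close>
  moreover have "derivation (d1 @ d') \<Longrightarrow> derivation d'" for d'
    by (induction d1) auto
  ultimately have "derivation (fact_code e e (f e) # d2)"
    using d(1) by blast
  then show ?thesis
    using assms(2)
    by (intro exI[of _ "list_encode (fact_code e e (f e) # d2)"])
      (auto simp: stage_def stage_index_def stage_value_def list_hd_def fact_code_def)
qed

section \<open>Block rotations and their strings\<close>

definition block_shift :: "(nat \<Rightarrow> nat) \<Rightarrow> nat \<Rightarrow> nat" where
  "block_shift h i = 4 * (i div 4) + (i mod 4 + h (i div 4)) mod 4"

text \<open>The outer \<open>mod 4\<close> sends exponent 0 to 0 rather than 4.\<close>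

definition neg4 :: "(nat \<Rightarrow> nat) \<Rightarrow> nat \<Rightarrow> nat" where
  "neg4 h k = (4 - h k) mod 4"

lemma block_shift_div [simp]: "block_shift h i div 4 = i div 4"
  by (simp add: block_shift_def)

lemma block_shift_mod: "block_shift h i mod 4 = (i mod 4 + h (i div 4)) mod 4"
  by (simp add: block_shift_def)

lemma block_shift_compose:
  "block_shift h \<circ> block_shift h' = block_shift (\<lambda>k. (h k + h' k) mod 4)"
proof
  fix i
  have "((i mod 4 + h' (i div 4)) mod 4 + h (i div 4)) mod 4 =
      (i mod 4 + (h (i div 4) + h' (i div 4)) mod 4) mod 4"
    by (simp add: mod_simps ac_simps)
  then show "(block_shift h \<circ> block_shift h') i = block_shift (\<lambda>k. (h k + h' k) mod 4) i"
    by (simp only: o_apply block_shift_def[of h "block_shift h' i"] block_shift_div block_shift_mod)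
      (simp add: block_shift_def)
qed

lemma block_shift_zero: "(\<And>k. h k = 0) \<Longrightarrow> block_shift h = id"
  by (auto simp: block_shift_def fun_eq_iff)

lemma block_shift_neg4:
  assumes "\<And>k. h k < 4"
  shows "block_shift h \<circ> block_shift (neg4 h) = id" "block_shift (neg4 h) \<circ> block_shift h = id"
proof -
  have "(h k + neg4 h k) mod 4 = 0" for k
    using less_imp_le[OF assms[of k]] by (simp add: neg4_def mod_simps)
  then show "block_shift h \<circ> block_shift (neg4 h) = id" "block_shift (neg4 h) \<circ> block_shift h = id"
    unfolding block_shift_compose by (auto intro!: block_shift_zero simp: add.commute)
qed

lemma bij_block_shift: "(\<And>k. h k < 4) \<Longrightarrow> bij (block_shift h)"
  using block_shift_neg4 by (metis o_bij)

lemma inv_block_shift: "(\<And>k. h k < 4) \<Longrightarrow> inv_into UNIV (block_shift h) = block_shift (neg4 h)"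
  using block_shift_neg4 by (metis inv_unique_comp)

text \<open>The first point of a block reveals its exponent; this is how exponents are read off from
  permutations and strings.\<close>

lemma block_shift_at_block: "h k < 4 \<Longrightarrow> block_shift h (4 * k) = 4 * k + h k"
  by (simp add: block_shift_def)

section \<open>Strings of permutations and their prefix order\<close>

lemma perm_string_Suc:
  "perm_string g (Suc n) = perm_string g n @ [g (Suc n), inv_into UNIV g (Suc n)]"
  by (simp add: perm_string_def)

lemma length_perm_string [simp]: "length (perm_string g n) = 2 * Suc n"
  by (induction n) (simp_all add: perm_string_Suc, simp add: perm_string_def)

lemma nth_perm_string:
  "i \<le> n \<Longrightarrow> perm_string g n ! (2 * i) = g i"
  "i \<le> n \<Longrightarrow> perm_string g n ! Suc (2 * i) = inv_into UNIV g i"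
proof (induction n)
  case 0
  {case 1 then show ?case by (simp add: perm_string_def)}
  {case 2 then show ?case by (simp add: perm_string_def)}
next
  case (Suc n)
  {case 1 with Suc show ?case by (cases "i = Suc n") (auto simp: perm_string_Suc nth_append)}
  {case 2 with Suc show ?case by (cases "i = Suc n") (auto simp: perm_string_Suc nth_append)}
qed

lemma eq_perm_string_iff:
  "l = perm_string g n \<longleftrightarrow> length l = 2 * Suc n \<and>
     (\<forall>i\<le>n. l ! (2 * i) = g i \<and> l ! Suc (2 * i) = inv_into UNIV g i)" (is "_ \<longleftrightarrow> ?R")
proof
  assume R: ?R
  show "l = perm_string g n"
  proof (rule nth_equalityI)
    fix j assume j: "j < length l"
    then show "l ! j = perm_string g n ! j"
      using R by (cases "even j") (auto elim!: evenE oddE simp: nth_perm_string)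
  qed (use R in simp)
qed (simp add: nth_perm_string)

lemma take_perm_string: "n \<le> m \<Longrightarrow> take (2 * Suc n) (perm_string g m) = perm_string g n"
  unfolding eq_perm_string_iff by (auto simp: nth_perm_string)

lemma strict_prefix_perm_string_iff:
  "strict_prefix (perm_string g n) (perm_string g' m) \<longleftrightarrow> n < m \<and> perm_string g n = perm_string g' n"
proof
  assume "strict_prefix (perm_string g n) (perm_string g' m)"
  then obtain zs where zs: "perm_string g' m = perm_string g n @ zs" "zs \<noteq> []"
    by (auto elim: strict_prefixE')
  then have "2 * Suc m = 2 * Suc n + length zs"
    by (metis length_append length_perm_string)
  then have "n < m"
    using zs(2) by (cases zs) auto
  moreover have "take (2 * Suc n) (perm_string g' m) = perm_string g n"
    using zs(1) by simp
  ultimately show "n < m \<and> perm_string g n = perm_string g' n"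
    using take_perm_string[of n m g'] by simp
next
  assume *: "n < m \<and> perm_string g n = perm_string g' n"
  then have "prefix (perm_string g n) (perm_string g' m)"
    by (metis take_is_prefix take_perm_string less_imp_le)
  moreover have "length (perm_string g n) \<noteq> length (perm_string g' m)"
    using * by simp
  ultimately show "strict_prefix (perm_string g n) (perm_string g' m)"
    by (metis strict_prefix_def)
qed

text \<open>Nodes only have lengths \<open>2 * Suc n\<close>, so an immediate successor appends two
  entries, the values of a permutation and of its inverse at \<open>Suc n\<close>.\<close>

lemma immediate_succs_perm_string:
  "immediate_succs (perm_tree G) (perm_string g n) =
     {perm_string g' (Suc n) | g'. g' \<in> G \<and> perm_string g' n = perm_string g n}"
  (is "?L = ?R")
proof (intro equalityI subsetI)
  fix l assume l: "l \<in> ?L"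
  then obtain g' m where m: "g' \<in> G" "l = perm_string g' m" "n < m" "perm_string g n = perm_string g' n"
    by (auto simp: immediate_succs_def perm_tree_def strict_prefix_perm_string_iff)
  have "perm_string g' (Suc n) \<in> perm_tree G"
    using m(1) by (auto simp: perm_tree_def)
  moreover have "strict_prefix (perm_string g n) (perm_string g' (Suc n))"
    using m by (simp add: strict_prefix_perm_string_iff)
  ultimately have "\<not> strict_prefix (perm_string g' (Suc n)) l"
    using l by (auto simp: immediate_succs_def)
  then have "m = Suc n"
    using m by (simp add: strict_prefix_perm_string_iff)
  then show "l \<in> ?R"
    using m by auto
next
  fix l assume "l \<in> ?R"
  then show "l \<in> ?L"
    by (auto simp: immediate_succs_def perm_tree_def strict_prefix_perm_string_iff)
qed

section \<open>Groups of block rotations with linked parities\<close>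

lemma mult_Sinf: "bij f \<Longrightarrow> bij g \<Longrightarrow> f \<otimes>\<^bsub>S\<^sub>\<infinity>\<^esub> g = f \<circ> g"
  by (auto simp: BijGroup_def Bij_def compose_def o_def)

text \<open>\<open>P\<close> marks the blocks whose parity is tied to another block,
  \<open>t k\<close>. As the target comes earlier, the constraints can be met block by block; as it
  is itself untied, its exponent will be 0 or 2, and half of it is a bit.\<close>

locale block_group =
  fixes P :: "nat \<Rightarrow> bool" and t :: "nat \<Rightarrow> nat"
  assumes t_less: "P k \<Longrightarrow> t k < k" and not_P_t: "P k \<Longrightarrow> \<not> P (t k)"
begin

definition parity :: "(nat \<Rightarrow> nat) \<Rightarrow> nat \<Rightarrow> nat" where
  "parity h k = (if P k then h (t k) div 2 else 0)"

definition exponents :: "(nat \<Rightarrow> nat) set" where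
  "exponents = {h. \<forall>k. h k < 4 \<and> h k mod 2 = parity h k}"

definition grp :: "(nat \<Rightarrow> nat) set" where
  "grp = block_shift ` exponents"

lemma exponents_less: "h \<in> exponents \<Longrightarrow> h k < 4"
  by (simp add: exponents_def)

lemma parity_cong: "(\<And>j. j < k \<Longrightarrow> h j = h' j) \<Longrightarrow> parity h k = parity h' k"
  by (simp add: parity_def t_less)

lemma exponents_mod: "h \<in> exponents \<Longrightarrow> h k mod 2 = parity h k"
  by (simp add: exponents_def)

lemma exponents_even: "h \<in> exponents \<Longrightarrow> \<not> P k \<Longrightarrow> h k mod 2 = 0"
  by (simp add: exponents_def parity_def)

text \<open>Halving the even residues modulo 4 is additive modulo 2, and so is reduction modulo 2;
  the parity condition therefore survives sums.\<close>

lemma exponents_add: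
  assumes h: "h \<in> exponents" "h' \<in> exponents" shows "(\<lambda>k. (h k + h' k) mod 4) \<in> exponents"
proof -
  have *: "(x + y) mod 4 mod 2 = (a + b) mod 4 div 2"
    if "a < 4" "a mod 2 = 0" "b < 4" "b mod 2 = 0" "x mod 2 = a div 2" "y mod 2 = b div 2"
    for a b x y :: nat
  proof -
    have "a = 0 \<or> a = 2" "b = 0 \<or> b = 2"
      using that(1-4) by presburger+
    then show ?thesis
      using that(5,6) by (elim disjE; simp; presburger)
  qed
  have "(h k + h' k) mod 4 mod 2 = parity (\<lambda>k. (h k + h' k) mod 4) k" for k
  proof (cases "P k")
    case True
    then show ?thesis
      using *[of "h (t k)" "h' (t k)" "h k" "h' k"] h[THEN exponents_mod, of k]
        h[THEN exponents_less, of "t k"] h[THEN exponents_even, of "t k"] not_P_t[of k]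
      by (simp add: parity_def)
  next
    case False
    then have "h k mod 2 = 0" "h' k mod 2 = 0"
      using h by (auto simp: exponents_even)
    then have "(h k + h' k) mod 4 mod 2 = 0"
      by presburger
    with False show ?thesis
      by (simp add: parity_def)
  qed
  then show ?thesis
    by (simp add: exponents_def)
qed

lemma exponents_neg4:
  assumes h: "h \<in> exponents" shows "neg4 h \<in> exponents"
proof -
  have *: "(4 - x) mod 4 mod 2 = (4 - a) mod 4 div 2"
    if "a < 4" "a mod 2 = 0" "x < 4" "x mod 2 = a div 2" for a x :: nat
  proof -
    have "a = 0 \<or> a = 2" "x = 0 \<or> x = 1 \<or> x = 2 \<or> x = 3"
      using that(1-3) by presburger+
    then show ?thesis
      using that(4) by auto
  qed
  have "neg4 h k mod 2 = parity (neg4 h) k" for k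
  proof (cases "P k")
    case True
    then show ?thesis
      using *[of "h (t k)" "h k"] exponents_mod[OF h, of k] exponents_less[OF h]
        exponents_even[OF h, of "t k"] not_P_t[of k]
      by (simp add: parity_def neg4_def)
  next
    case False
    then have "h k mod 2 = 0"
      using h by (simp add: exponents_even)
    then have "h k = 0 \<or> h k = 2"
      using exponents_less[OF h, of k] by presburger
    then have "(4 - h k) mod 4 mod 2 = 0"
      by auto
    with False show ?thesis
      by (simp add: parity_def neg4_def)
  qed
  then show ?thesis
    by (simp add: exponents_def neg4_def)
qed

lemma exponents_zero: "(\<lambda>_. 0) \<in> exponents"
  by (simp add: exponents_def parity_def)

lemma exponents_extend:
  assumes "\<And>k. k < K \<Longrightarrow> h k < 4 \<and> h k mod 2 = parity h k"
  obtains h' where "h' \<in> exponents" "\<And>k. k < K \<Longrightarrow> h' k = h k"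
proof
  \<comment> \<open>New tied blocks copy the bit of a target below \<open>K\<close>. All other new
    exponents are 0; this also suits tied blocks with a new target, since that target is untied and
    gets 0.\<close>
  define h' where "h' k = (if k < K then h k else if P k \<and> t k < K then h (t k) div 2 else 0)" for k
  have *: "a < 4 \<Longrightarrow> a div 2 < 4 \<and> a div 2 mod 2 = a div 2" for a :: nat
    by auto
  have "h' k < 4 \<and> h' k mod 2 = parity h' k" for k
  proof (cases "k < K")
    case True
    then show ?thesis
      using assms[of k] t_less[of k] by (auto simp: h'_def parity_def)
  next
    case False
    then show ?thesis
      using *[of "h (t k)"] assms[of "t k"] not_P_t[of k] by (auto simp: h'_def parity_def)
  qed
  then show "h' \<in> exponents"
    by (simp add: exponents_def)
qed simp

lemma bij_grp: "g \<in> grp \<Longrightarrow> bij g"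
  by (auto simp: grp_def bij_block_shift exponents_less)

lemma subgroup_grp: "subgroup grp S\<^sub>\<infinity>"
proof -
  interpret S: group "S\<^sub>\<infinity> :: (nat \<Rightarrow> nat) monoid"
    by (rule group_BijGroup)
  have sub: "grp \<subseteq> carrier S\<^sub>\<infinity>"
    using bij_grp by (auto simp: BijGroup_def Bij_def)
  show ?thesis
  proof (rule S.subgroupI[OF sub])
    show "grp \<noteq> {}"
      using exponents_zero by (auto simp: grp_def)
  next
    fix g assume g: "g \<in> grp"
    then have "inv\<^bsub>S\<^sub>\<infinity>\<^esub> g = inv_into UNIV g"
      using bij_grp[OF g] by (subst inv_BijGroup) (auto simp: Bij_def)
    moreover obtain h where "h \<in> exponents" "g = block_shift h"
      using g by (auto simp: grp_def)
    ultimately show "inv\<^bsub>S\<^sub>\<infinity>\<^esub> g \<in> grp"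
      using inv_block_shift[of h] exponents_neg4[of h] exponents_less[of h] by (simp add: grp_def)
  next
    fix f g assume "f \<in> grp" "g \<in> grp"
    then show "f \<otimes>\<^bsub>S\<^sub>\<infinity>\<^esub> g \<in> grp"
      by (auto simp: mult_Sinf bij_grp) (auto simp: grp_def block_shift_compose exponents_add)
  qed
qed

section \<open>Closedness under pointwise limits and profiniteness\<close>

lemma grp_limit:
  assumes "\<And>n. \<exists>g\<in>grp. \<forall>i\<in>{..n}. g i = f i"
  shows "f \<in> grp"
proof -
  \<comment> \<open>The exponents of the limit are read off at the first points of the blocks. Each
    constraint concerns finitely many blocks, on which \<open>f\<close> agrees with an element of
    the group.\<close>
  define h where "h k = f (4 * k) - 4 * k" for k
  have *: "\<exists>h'\<in>exponents. (\<forall>j\<le>k. h j = h' j) \<and> (\<forall>i<4 * Suc k. f i = block_shift h' i)" for k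
  proof -
    obtain h' where h': "h' \<in> exponents" "\<And>i. i < 4 * Suc k \<Longrightarrow> f i = block_shift h' i"
      using assms[of "4 * Suc k"] by (fastforce simp: grp_def)
    moreover have "h j = h' j" if "j \<le> k" for j
      using h'(2)[of "4 * j"] that block_shift_at_block[of h' j] exponents_less[OF h'(1)]
      by (simp add: h_def)
    ultimately show ?thesis
      by blast
  qed
  have "h k < 4 \<and> h k mod 2 = parity h k" for k
  proof -
    obtain h' where "h' \<in> exponents" "\<forall>j\<le>k. h j = h' j"
      using *[of k] by blast
    then show ?thesis
      using parity_cong[of k h h'] by (simp add: exponents_def)
  qed
  then have "h \<in> exponents"
    by (simp add: exponents_def)
  moreover have "f i = block_shift h i" for i
  proof -
    obtain h' where "\<forall>j\<le>i div 4. h j = h' j" "\<forall>j<4 * Suc (i div 4). f j = block_shift h' j"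
      using *[of "i div 4"] by blast
    moreover have "i < 4 * Suc (i div 4)"
      by simp
    ultimately show ?thesis
      by (simp only: block_shift_def order_refl)
  qed
  ultimately show ?thesis
    by (auto simp: grp_def)
qed

lemma closed_grp: "closed grp"
  unfolding closed_def
proof (rule Topological_Spaces.openI)
  fix f assume "f \<in> - grp"
  then obtain n where "\<forall>g\<in>grp. \<not> (\<forall>i\<in>{..n}. g i = f i)"
    using grp_limit[of f] by blast
  then show "\<exists>T. open T \<and> f \<in> T \<and> T \<subseteq> - grp"
    by (intro exI[of _ "{h. \<forall>i\<in>{..n}. h i = f i}"]) (auto intro: open_agree[OF finite_atMost])
qed

lemma profinite_grp: "profinite_subgroup grp"
  unfolding profinite_subgroup_iff
proof (intro conjI allI subgroup_grp)
  show "closedin (top_of_set (carrier S\<^sub>\<infinity>)) grp"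
    by (rule closed_subset[OF subgroup.subset[OF subgroup_grp] closed_grp])
  fix n
  have "{g n |g. g \<in> grp} \<subseteq> {..<4 * (n div 4) + 4}"
    by (auto simp: grp_def block_shift_def)
  then show "finite {g n |g. g \<in> grp}"
    by (rule finite_subset) simp
qed

section \<open>Nodes and branching of the tree\<close>

lemma perm_string_block_shift_eq_iff:
  assumes "h \<in> exponents" "h' \<in> exponents"
  shows "perm_string (block_shift h) n = perm_string (block_shift h') n \<longleftrightarrow> (\<forall>k\<le>n div 4. h k = h' k)"
    (is "?L \<longleftrightarrow> ?R")
proof
  assume L: ?L
  show ?R
  proof (intro allI impI)
    fix k assume "k \<le> n div 4"
    \<comment> \<open>The first point of block \<open>k\<close> is at most \<open>n\<close>, so the
      string already contains its exponent.\<close>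
    then have "block_shift h (4 * k) = block_shift h' (4 * k)"
      using L nth_perm_string(1)[of "4 * k" n] by (metis div_times_less_eq_dividend mult.commute mult_le_mono1 order_trans)
    then show "h k = h' k"
      using assms by (simp add: block_shift_at_block exponents_less)
  qed
next
  assume ?R
  then show ?L
    unfolding eq_perm_string_iff
    using assms by (auto simp: nth_perm_string inv_block_shift exponents_less block_shift_def neg4_def div_le_mono)
qed

text \<open>Only when \<open>Suc n\<close> opens a new block is there a choice: the exponent there
  has a prescribed parity \<open>p\<close>, so it is \<open>p\<close> or \<open>p + 2\<close>, and
  both extend to the whole group.\<close>

lemma card_immediate_succs:
  assumes h: "h \<in> exponents"
  shows "card (immediate_succs (perm_tree grp) (perm_string (block_shift h) n)) =
    (if Suc n mod 4 = 0 then 2 else 1)"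
proof -
  let ?S = "immediate_succs (perm_tree grp) (perm_string (block_shift h) n)"
  have S: "?S = {perm_string (block_shift h') (Suc n) | h'. h' \<in> exponents \<and> (\<forall>k\<le>n div 4. h' k = h k)}"
    using h unfolding immediate_succs_perm_string by (auto simp: grp_def perm_string_block_shift_eq_iff)
  show ?thesis
  proof (cases "Suc n mod 4 = 0")
    case False
    then have "Suc n div 4 = n div 4"
      by (simp add: div_Suc)
    then have "?S = {perm_string (block_shift h) (Suc n)}"
      unfolding S using h by (auto simp: perm_string_block_shift_eq_iff)
    with False show ?thesis
      by simp
  next
    case True
    define K where "K = Suc n div 4"
    have K: "K = Suc (n div 4)"
      using True by (simp add: div_Suc K_def)
    define p where "p = parity h K"
    have "p \<le> 1"
      using exponents_less[OF h, of "t K"] by (auto simp: p_def parity_def)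
    have ext: "\<exists>h'. h' \<in> exponents \<and> (\<forall>k\<le>n div 4. h' k = h k) \<and> h' K = b" if "b < 4" "b mod 2 = p" for b
    proof -
      have "(h(K := b)) k < 4 \<and> (h(K := b)) k mod 2 = parity (h(K := b)) k" if "k < Suc K" for k
        using h that \<open>b < 4\<close> \<open>b mod 2 = p\<close> parity_cong[of k "h(K := b)" h]
        by (auto simp: exponents_def p_def less_Suc_eq)
      then obtain h' where "h' \<in> exponents" "\<And>k. k < Suc K \<Longrightarrow> h' k = (h(K := b)) k"
        using exponents_extend[of "Suc K" "h(K := b)"] by blast
      then show ?thesis
        by (intro exI[of _ h']) (auto simp: K)
    qed
    obtain h1 where h1: "h1 \<in> exponents" "\<forall>k\<le>n div 4. h1 k = h k" "h1 K = p"
      using ext[of p] \<open>p \<le> 1\<close> by auto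
    obtain h2 where h2: "h2 \<in> exponents" "\<forall>k\<le>n div 4. h2 k = h k" "h2 K = p + 2"
      using ext[of "p + 2"] \<open>p \<le> 1\<close> by auto
    have *: "h' K = p \<or> h' K = p + 2" if "h' \<in> exponents" "\<forall>k\<le>n div 4. h' k = h k" for h'
    proof -
      have "parity h' K = p"
        using that parity_cong[of K h' h] by (simp add: K p_def)
      then have "h' K < 4" "h' K mod 2 = p"
        using that(1) by (auto simp: exponents_def)
      then show ?thesis
        by presburger
    qed
    have eq: "perm_string (block_shift h') (Suc n) = perm_string (block_shift h'') (Suc n)"
      if "h' \<in> exponents" "h'' \<in> exponents" "\<forall>k\<le>n div 4. h' k = h k" "\<forall>k\<le>n div 4. h'' k = h k" "h' K = h'' K"
      for h' h''
      using that by (auto simp: perm_string_block_shift_eq_iff K_def[symmetric] K le_Suc_eq)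
    have "?S = {perm_string (block_shift h1) (Suc n), perm_string (block_shift h2) (Suc n)}"
    proof (intro equalityI subsetI)
      fix l assume "l \<in> ?S"
      then obtain h' where h': "l = perm_string (block_shift h') (Suc n)" "h' \<in> exponents" "\<forall>k\<le>n div 4. h' k = h k"
        unfolding S by blast
      then show "l \<in> {perm_string (block_shift h1) (Suc n), perm_string (block_shift h2) (Suc n)}"
        using *[OF h'(2,3)] eq[OF h'(2) h1(1) h'(3) h1(2)] eq[OF h'(2) h2(1) h'(3) h2(2)] h1(3) h2(3) by auto
    qed (use h1 h2 S in blast)
    moreover have "perm_string (block_shift h1) (Suc n) \<noteq> perm_string (block_shift h2) (Suc n)"
      using h1 h2 by (auto simp: perm_string_block_shift_eq_iff K_def[symmetric])
    ultimately show ?thesis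
      using True by simp
  qed
qed

text \<open>Position \<open>8 * k\<close> holds the image of \<open>4 * k\<close> and hence the
  exponent of block \<open>k\<close>. Local conditions suffice because consistent initial exponents
  always extend. An entry below \<open>4 * k\<close> is truncated to exponent 0 and then fails the
  comparison with \<open>block_shift h\<close>.\<close>

lemma mem_perm_tree_iff:
  fixes l :: "nat list"
  defines "h \<equiv> \<lambda>k. l ! (8 * k) - 4 * k"
  shows "l \<in> perm_tree grp \<longleftrightarrow> (\<exists>n. length l = 2 * Suc n \<and>
    (\<forall>i\<le>n. h (i div 4) < 4 \<and> h (i div 4) mod 2 = parity h (i div 4) \<and>
       l ! (2 * i) = block_shift h i \<and> l ! Suc (2 * i) = block_shift (neg4 h) i))"
    (is "_ \<longleftrightarrow> (\<exists>n. ?R n)")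
proof -
  have "?R n" if h': "h' \<in> exponents" and l: "l = perm_string (block_shift h') n" for h' n
  proof -
    have hh': "h k = h' k" if "k \<le> n div 4" for k
    proof -
      have "4 * k \<le> n"
        using that by auto
      then show ?thesis
        using nth_perm_string(1)[of "4 * k" n "block_shift h'"] exponents_less[OF h', of k]
        by (simp add: h_def l block_shift_at_block)
    qed
    have "h (i div 4) = h' (i div 4) \<and> parity h (i div 4) = parity h' (i div 4)" if "i \<le> n" for i
      using hh' div_le_mono[OF that, of 4] by (auto intro!: parity_cong)
    then show ?thesis
      using h' by (auto simp: l nth_perm_string inv_block_shift exponents_less block_shift_def neg4_def)
        (auto simp: exponents_def)
  qed
  moreover have "l \<in> perm_tree grp" if R: "?R n" for n
  proof -
    have "h k < 4 \<and> h k mod 2 = parity h k" if "k < Suc (n div 4)" for k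
      using R that by (auto dest: spec[of _ "4 * k"])
    then obtain h' where h': "h' \<in> exponents" "\<And>k. k < Suc (n div 4) \<Longrightarrow> h' k = h k"
      using exponents_extend[of "Suc (n div 4)" h] by blast
    have "h' (i div 4) = h (i div 4)" if "i \<le> n" for i
      using h'(2) div_le_mono[OF that, of 4] by simp
    then have "l = perm_string (block_shift h') n"
      unfolding eq_perm_string_iff
      using R h'(1) by (auto simp: inv_block_shift exponents_less block_shift_def neg4_def)
    then show ?thesis
      using h'(1) by (auto simp: perm_tree_def grp_def)
  qed
  ultimately show ?thesis
    by (auto simp: perm_tree_def grp_def)
qed

end

section \<open>Computability of the tree and its branching\<close>

lemma computable_block_shift:
  assumes "computable h" shows "computable (block_shift h)"
  unfolding block_shift_def by (intro computable_intros assms[THEN computable_compose])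

context block_group
begin

lemma decidable_perm_tree:
  assumes P: "decidable P" and t: "computable t"
  shows "decidable (\<lambda>c. list_decode c \<in> perm_tree grp)"
proof -
  define N where "N c i = list_hd ((list_tl ^^ i) c)" for c i
  have N [computable_intros]: "computable f \<Longrightarrow> computable g \<Longrightarrow> computable (\<lambda>x. N (f x) (g x))" for f g
    unfolding N_def by (intro computable_intros)
  define h where "h c k = N c (8 * k) - 4 * k" for c k
  have h [computable_intros]: "computable f \<Longrightarrow> computable g \<Longrightarrow> computable (\<lambda>x. h (f x) (g x))" for f g
    unfolding h_def by (intro computable_intros)
  \<comment> \<open>The length of the list is at most \<open>c\<close>, which bounds
    \<open>n\<close>. The lookup \<open>N\<close> is only known to agree with \<open>!\<close>
    inside the list, hence the range checks that follow.\<close>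
  have eq: "list_decode c \<in> perm_tree grp \<longleftrightarrow>
    (\<exists>n<c. length (list_decode c) = 2 * Suc n \<and>
      (\<forall>i<Suc n. h c (i div 4) < 4 \<and> h c (i div 4) mod 2 = parity (h c) (i div 4) \<and>
       N c (2 * i) = block_shift (h c) i \<and> N c (Suc (2 * i)) = block_shift (neg4 (h c)) i))" for c
  proof -
    define l where "l = list_decode c"
    define h' where "h' k = l ! (8 * k) - 4 * k" for k
    have "(h' (i div 4) < 4 \<and> h' (i div 4) mod 2 = parity h' (i div 4) \<and>
       l ! (2 * i) = block_shift h' i \<and> l ! Suc (2 * i) = block_shift (neg4 h') i) \<longleftrightarrow>
      (h c (i div 4) < 4 \<and> h c (i div 4) mod 2 = parity (h c) (i div 4) \<and>
       N c (2 * i) = block_shift (h c) i \<and> N c (Suc (2 * i)) = block_shift (neg4 (h c)) i)"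
      if "length l = 2 * Suc n" "i \<le> n" for i n
    proof -
      have N: "N c j = l ! j" if "j < 2 * Suc n" for j
        using that \<open>length l = 2 * Suc n\<close> list_hd_drop[of j c] by (simp add: N_def l_def)
      have h: "h c k = h' k" if "k \<le> i div 4" for k
      proof -
        have "4 * k \<le> i"
          using that by auto
        then have "8 * k < 2 * Suc n"
          using \<open>i \<le> n\<close> by simp
        then show ?thesis
          using N[of "8 * k"] by (simp add: h_def h'_def)
      qed
      have "parity (h c) (i div 4) = parity h' (i div 4)"
        by (rule parity_cong) (simp add: h)
      then show ?thesis
        using that N[of "2 * i"] N[of "Suc (2 * i)"] h[of "i div 4"]
        by (simp add: block_shift_def neg4_def)
    qed
    moreover have "n < c" if "length l = 2 * Suc n" for n
      using that length_list_decode_le[of c] by (simp add: l_def)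
    ultimately show ?thesis
      unfolding mem_perm_tree_iff l_def[symmetric] h'_def[symmetric] less_Suc_eq_le
      by (metis (no_types, lifting))
  qed
  show ?thesis
    unfolding eq parity_def block_shift_def neg4_def
    by (intro computable_intros P[THEN decidable_compose] t[THEN computable_compose])
qed

lemma tree_degree_grp:
  assumes P: "decidable P" and t: "computable t"
  shows "tree_degree (perm_tree grp) = \<zero>\<^sub>T"
proof -
  note T = decidable_perm_tree[OF assms]
  have "branching (perm_tree grp) c = (if list_decode c \<in> perm_tree grp then
    (if \<exists>n<c. length (list_decode c) = 2 * Suc n \<and> Suc n mod 4 = 0 then 2 else 1)
    else 0)" for c
  proof (cases "list_decode c \<in> perm_tree grp")
    case True
    then obtain h m where m: "h \<in> exponents" "list_decode c = perm_string (block_shift h) m"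
      by (auto simp: perm_tree_def grp_def)
    have "m < c"
      using length_list_decode_le[of c] by (simp add: m(2))
    then have "(\<exists>n<c. length (list_decode c) = 2 * Suc n \<and> Suc n mod 4 = 0) \<longleftrightarrow> Suc m mod 4 = 0"
      by (auto simp: m(2))
    then show ?thesis
      using True card_immediate_succs[OF m(1), of m] by (simp add: branching_def m(2))
  qed (simp add: branching_def)
  then have "branching (perm_tree grp) = (\<lambda>c. if list_decode c \<in> perm_tree grp then
    (if \<exists>n<c. length (list_decode c) = 2 * Suc n \<and> Suc n mod 4 = 0 then 2 else 1)
    else 0)"
    by (rule ext)
  then have "computable (branching (perm_tree grp))"
    by (simp only:) (intro computable_intros T)
  moreover have "computable (tree_char (perm_tree grp))"
    unfolding tree_char_def by (intro computable_intros T)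
  ultimately show ?thesis
    unfolding tree_degree_def turing_deg_eq_zero_iff by (rule computable_turing_join[rotated])
qed

end

section \<open>A square without computable square root\<close>

definition stage_block :: "nat \<Rightarrow> bool" where
  "stage_block k \<longleftrightarrow> k mod 2 = 1 \<and> stage (k div 2)"

definition stage_target :: "nat \<Rightarrow> nat" where
  "stage_target k = 2 * stage_index (k div 2)"

interpretation diag: block_group stage_block stage_target
proof
  fix k assume "stage_block k"
  then show "stage_target k < k" "\<not> stage_block (stage_target k)"
    using stage_index_less[of "k div 2"] by (auto simp: stage_block_def stage_target_def)
qed

definition square_exponents :: "nat \<Rightarrow> nat" where
  "square_exponents k = (if stage_block k then 2 * stage_value (k div 2) else 0)"

text \<open>Of the two solutions \<open>v\<close> and \<open>v + 2\<close> of doubling to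
  \<open>2 * v\<close>, stage blocks take \<open>v\<close>. An even block records whether some stage
  of its program has value 1, an unbounded question; programs without a stage get 0.\<close>

definition root_exponents :: "nat \<Rightarrow> nat" where
  "root_exponents k =
    (if stage_block k then stage_value (k div 2)
     else if k mod 2 = 0 \<and> (\<exists>c. stage c \<and> stage_index c = k div 2 \<and> stage_value c = 1) then 2
     else 0)"

lemma decidable_stage_block: "decidable stage_block"
  unfolding stage_block_def by (intro computable_intros)

lemma computable_stage_target: "computable stage_target"
  unfolding stage_target_def by (intro computable_intros)

lemma stage_value_cases: "stage_block k \<Longrightarrow> stage_value (k div 2) = 0 \<or> stage_value (k div 2) = 1"
  by (auto simp: stage_block_def stage_def)

lemma square_exponents_mem: "square_exponents \<in> diag.exponents"
proof -
  have "square_exponents (stage_target k) = 0" if "stage_block k" for k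
    using diag.not_P_t[OF that] by (simp add: square_exponents_def)
  moreover have "square_exponents k < 4 \<and> square_exponents k mod 2 = 0" for k
    using stage_value_cases[of k] by (auto simp: square_exponents_def)
  ultimately show ?thesis
    by (simp add: diag.exponents_def diag.parity_def)
qed

lemma root_exponents_mem: "root_exponents \<in> diag.exponents"
proof -
  have "root_exponents (stage_target k) div 2 = stage_value (k div 2)" if k: "stage_block k" for k
  proof -
    have s: "stage (k div 2)" "\<not> stage_block (stage_target k)"
      using k diag.not_P_t[OF k] by (auto simp: stage_block_def)
    have "(\<exists>c. stage c \<and> stage_index c = stage_index (k div 2) \<and> stage_value c = 1) \<longleftrightarrow>
        stage_value (k div 2) = 1"
      using s(1) stage_value_unique by metis
    then show ?thesis
      using s stage_value_cases[OF k] by (auto simp: root_exponents_def stage_target_def)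
  qed
  moreover have "root_exponents k < 4 \<and> root_exponents k mod 2 = (if stage_block k then stage_value (k div 2) else 0)" for k
    using stage_value_cases[of k] by (auto simp: root_exponents_def)
  ultimately show ?thesis
    by (simp add: diag.exponents_def diag.parity_def)
qed

text \<open>On even blocks \<open>2 + 2\<close> vanishes modulo 4, so squaring erases the bit
  recorded there.\<close>

lemma root_compose_root:
  "block_shift root_exponents \<circ> block_shift root_exponents = block_shift square_exponents"
proof -
  have "(root_exponents k + root_exponents k) mod 4 = square_exponents k" for k
    using stage_value_cases[of k] by (auto simp: root_exponents_def square_exponents_def)
  then show ?thesis
    by (simp add: block_shift_compose)
qed

text \<open>From a computable root one reads off a computable function that differs from every stage value
  at the stage index.\<close>

lemma no_computable_root:
  assumes "computable x" "x \<in> diag.grp" "x \<circ> x = block_shift square_exponents"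
  shows False
proof -
  obtain h where h: "h \<in> diag.exponents" "x = block_shift h"
    using assms(2) by (auto simp: diag.grp_def)
  have sq: "(h k + h k) mod 4 = square_exponents k" for k
  proof -
    have "block_shift (\<lambda>k. (h k + h k) mod 4) (4 * k) = block_shift square_exponents (4 * k)"
      using assms(3) by (simp add: h(2) block_shift_compose)
    then show ?thesis
      using diag.exponents_less[OF square_exponents_mem, of k] by (simp add: block_shift_at_block)
  qed
  \<comment> \<open>Block \<open>2 * n\<close> begins at \<open>8 * n\<close>, which
    \<open>x\<close> fixes iff the exponent there is 0. The function thus flips the bit that the
    root stores for program \<open>n\<close>.\<close>
  have "computable (\<lambda>n. of_bool (x (8 * n) = 8 * n))"
    by (intro computable_intros assms(1)[THEN computable_compose])
  then have "\<exists>c. stage c \<and> stage_value c = of_bool (x (8 * stage_index c) = 8 * stage_index c)"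
    by (rule exists_stage) simp
  then obtain c
    where c: "stage c" "stage_value c = of_bool (x (8 * stage_index c) = 8 * stage_index c)"
    by blast
  define k where "k = Suc (2 * c)"
  have k: "stage_block k" "stage_target k = 2 * stage_index c" "k div 2 = c"
    using c(1) by (auto simp: k_def stage_block_def stage_target_def)
  have "x (8 * stage_index c) = 8 * stage_index c + h (2 * stage_index c)"
    using block_shift_at_block[of h "2 * stage_index c"] diag.exponents_less[OF h(1)] by (simp add: h(2))
  then have c2: "stage_value c = of_bool (h (2 * stage_index c) = 0)"
    using c(2) by simp
  have "h k mod 2 = h (2 * stage_index c) div 2"
    using diag.exponents_mod[OF h(1), of k] k by (simp add: diag.parity_def)
  moreover have "h (2 * stage_index c) mod 2 = 0"
    using diag.exponents_even[OF h(1) diag.not_P_t[OF k(1)]] k(2) by simp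
  moreover have "(h k + h k) mod 4 = 2 * stage_value c"
    using sq[of k] k by (simp add: square_exponents_def)
  \<comment> \<open>The root conditions give
    \<open>stage_value c = h (2 * stage_index c) div 2\<close> with this exponent 0 or 2, while
    \<open>c2\<close> gives the opposite bit.\<close>
  ultimately show False
    using c2 diag.exponents_less[OF h(1), of "2 * stage_index c"]
    by (cases "h (2 * stage_index c) = 0") (simp_all, presburger+)
qed

theorem theorem5:
  shows "\<exists>G. profinite_subgroup G \<and> tree_degree (perm_tree G) = \<zero>\<^sub>T \<and>
    (\<exists>\<phi> as. existential \<phi> \<and> free_vars \<phi> \<subseteq> {..<length as} \<and>
       set as \<subseteq> ideal_part G {\<zero>\<^sub>T} \<and>
       satisfies (S\<^sub>\<infinity>\<lparr>carrier := G\<rparr>) as \<phi> \<and>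
       \<not> satisfies (S\<^sub>\<infinity>\<lparr>carrier := ideal_part G {\<zero>\<^sub>T}\<rparr>) as \<phi>)"
proof -
  let ?G = "diag.grp"
  let ?a = "block_shift square_exponents"
  \<comment> \<open>\<open>Var 0\<close> is the quantified root and \<open>Var 1\<close> the
    parameter, as a quantifier extends the tuple at the front.\<close>
  let ?\<phi> = "Exists (Eq (Mult (Var 0) (Var 0)) (Var 1))"
  have part: "ideal_part ?G {\<zero>\<^sub>T} = {g \<in> ?G. computable g}"
    by (simp add: ideal_part_def turing_deg_eq_zero_iff)
  have mult: "g \<otimes>\<^bsub>S\<^sub>\<infinity>\<^esub> g = g \<circ> g" if "g \<in> ?G" for g
    by (simp add: mult_Sinf diag.bij_grp that)
  have "computable square_exponents"
    unfolding square_exponents_def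
    by (intro computable_intros decidable_stage_block[THEN decidable_compose])
  then have a: "?a \<in> ideal_part ?G {\<zero>\<^sub>T}"
    using square_exponents_mem unfolding part by (simp add: computable_block_shift diag.grp_def)
  have root: "block_shift root_exponents \<in> ?G"
    using root_exponents_mem by (simp add: diag.grp_def)
  have "satisfies (S\<^sub>\<infinity>\<lparr>carrier := ?G\<rparr>) [?a] ?\<phi>"
    using root mult[OF root] root_compose_root by auto
  moreover have "\<not> satisfies (S\<^sub>\<infinity>\<lparr>carrier := ideal_part ?G {\<zero>\<^sub>T}\<rparr>) [?a] ?\<phi>"
    using mult no_computable_root by (auto simp: part)
  moreover have "existential ?\<phi>"
    by (intro existential.intros(2) existential.intros(1)) simp
  moreover have "free_vars ?\<phi> \<subseteq> {..<length [?a]}"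
    by auto
  moreover have "set [?a] \<subseteq> ideal_part ?G {\<zero>\<^sub>T}"
    using a by simp
  ultimately show ?thesis
    using diag.profinite_grp diag.tree_degree_grp[OF decidable_stage_block computable_stage_target]
    by blast
qed

end
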